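(* Let $\mathbb{F}$ be a field, $S$ and $T$ monoids, $B$ an $S$-graded $\mathbb{F}$-algebra, $C$ a $T$-graded $\mathbb{F}$-algebra, and $\mu\in Z^2(S\times T,\mathbb{F}^\times)$. Suppose that the Yamazaki factorization of $\mu$ is $Y(\mu)=(\nu,\xi,1/\alpha)$, where $\nu\in Z^2(S,\mathbb{F}^\times)$, $\xi\in Z^2(T,\mathbb{F}^\times)$ and $\alpha\in P(S,T,\mathbb{F}^\times)$. Then the twisted algebra $(B\otimes C)_\mu$ is isomorphic to the twisted tensor product $B_\nu\otimes_\alpha C_\xi$.
   Context: For a monoid $S$ with identity $e$, $Z^2(S,\mathbb{F}^\times)$ is the group of cocycles: maps $\mu\colon S\times S\to\mathbb{F}^\times$ with $\mu(x,yz)\mu(y,z)=\mu(x,y)\mu(xy,z)$ and $\mu(x,e)=\mu(e,x)=1$. $P(S,T,\mathbb{F}^\times)$ is the group (under pointwise multiplication) of bimultiplicative pairings: maps $\alpha\colon S\times T\to\mathbb{F}^\times$ multiplicative in each argument separately. For $\mu\in Z^2(S\times T,\mathbb{F}^\times)$, the Yamazaki factorization is $Y(\mu)=(\mu|_S,\mu|_T,\alpha_\mu)$, where $S$ is identified with $S\times\{e_T\}$, $T$ with $\{e_S\}\times T$, $\mu|_S,\mu|_T$ are the restrictions, and $\alpha_\mu(s,t)=\mu((s,e_T),(e_S,t))/\mu((e_S,t),(s,e_T))$. An $S$-graded $\mathbb{F}$-algebra is a unital associative algebra $A=\bigoplus_{s\in S}A_s$ with $A_sA_t\subseteq A_{st}$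 and $1_A\in A_e$. The twist $A_\mu$ of $A$ by $\mu\in Z^2(S,\mathbb{F}^\times)$ is a copy of the graded vector space $A$ (with isomorphism $a\mapsto a'$) with product $a'*b'=\mu(x,y)(ab)'$ for $a\in A_x$, $b\in A_y$; it is again an $S$-graded algebra. $B\otimes C$ is the classical tensor product algebra, $(b\otimes c)(b'\otimes c')=bb'\otimes cc'$, graded by $S\times T$ via $(B\otimes C)_{(s,t)}=B_s\otimes C_t$. For an $S$-graded algebra $B$, a $T$-graded algebra $C$ and $\alpha\in P(S,T,\mathbb{F}^\times)$, the $\alpha$-twisted tensor product $B\otimes_\alpha C$ is the $S\times T$-graded algebra with underlying vector space $B\otimes C$ and product $(b\otimes c)*(b'\otimes c')=\alpha(s,t)\,bb'\otimes cc'$ whenever $b'\in B_s$, $c\in C_t$ (so $c*b=\alpha(s,t)\,b\otimes c$ for $b\in B_s$, $c\in C_t$). *)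

theory Defs
  imports "HOL-Algebra.Module" "HOL-Algebra.QuotRing" "HOL-Library.FuncSet"
begin

section \<open>Graded algebras\<close>

text \<open>
  The library locale \<^locale>\<open>algebra\<close> is restricted to commutative algebras, whence the following
  (possibly noncommutative) variant.
\<close>

locale assoc_algebra = module R M + ring M for R and M (structure) +
  assumes smult_mult_left:
      "\<lbrakk>r \<in> carrier R; x \<in> carrier M; y \<in> carrier M\<rbrakk> \<Longrightarrow>
        (r \<odot>\<^bsub>M\<^esub> x) \<otimes>\<^bsub>M\<^esub> y = r \<odot>\<^bsub>M\<^esub> (x \<otimes>\<^bsub>M\<^esub> y)"
    and smult_mult_right:
      "\<lbrakk>r \<in> carrier R; x \<in> carrier M; y \<in> carrier M\<rbrakk> \<Longrightarrow>
        x \<otimes>\<^bsub>M\<^esub> (r \<odot>\<^bsub>M\<^esub> y) = r \<odot>\<^bsub>M\<^esub> (x \<otimes>\<^bsub>M\<^esub> y)"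

record ('f, 'a, 's) graded_algebra = "('f, 'a) module" +
  hom_part :: "'s \<Rightarrow> 'a set"

definition is_hom_decomp ::
  "('s, 'x) monoid_scheme \<Rightarrow> ('f, 'a, 's, 'y) graded_algebra_scheme \<Rightarrow> 'a \<Rightarrow> ('s \<Rightarrow> 'a) \<Rightarrow> bool"
  where "is_hom_decomp S A a f \<longleftrightarrow>
    f \<in> (\<Pi>\<^sub>E s\<in>carrier S. hom_part A s) \<and>
    finite {s \<in> carrier S. f s \<noteq> \<zero>\<^bsub>A\<^esub>} \<and>
    a = (\<Oplus>\<^bsub>A\<^esub> s \<in> {s \<in> carrier S. f s \<noteq> \<zero>\<^bsub>A\<^esub>}. f s)"

locale graded_algebra = assoc_algebra F A
  for F :: "('f, 'x) ring_scheme" (structure)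
    and S :: "('s, 'y) monoid_scheme"
    and A :: "('f, 'a, 's, 'z) graded_algebra_scheme" (structure) +
  assumes hom_part_submodule: "s \<in> carrier S \<Longrightarrow> submodule (hom_part A s) F A"
    and direct_sum: "a \<in> carrier A \<Longrightarrow> \<exists>!f. is_hom_decomp S A a f"
    and hom_part_mult:
      "\<lbrakk>s \<in> carrier S; t \<in> carrier S; a \<in> hom_part A s; b \<in> hom_part A t\<rbrakk> \<Longrightarrow>
        a \<otimes>\<^bsub>A\<^esub> b \<in> hom_part A (s \<otimes>\<^bsub>S\<^esub> t)"
    and hom_part_one: "\<one>\<^bsub>A\<^esub> \<in> hom_part A \<one>\<^bsub>S\<^esub>"

definition hom_comp ::
  "('s, 'x) monoid_scheme \<Rightarrow> ('f, 'a, 's, 'y) graded_algebra_scheme \<Rightarrow> 'a \<Rightarrow> 's \<Rightarrow> 'a"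
  where "hom_comp S A a = (THE f. is_hom_decomp S A a f)"

definition hom_supp ::
  "('s, 'x) monoid_scheme \<Rightarrow> ('f, 'a, 's, 'y) graded_algebra_scheme \<Rightarrow> 'a \<Rightarrow> 's set"
  where "hom_supp S A a = {s \<in> carrier S. hom_comp S A a s \<noteq> \<zero>\<^bsub>A\<^esub>}"

definition graded_algebra_iso ::
  "('f, 'x) ring_scheme \<Rightarrow> ('s, 'y) monoid_scheme \<Rightarrow>
    ('f, 'a, 's, 'z) graded_algebra_scheme \<Rightarrow> ('f, 'b, 's, 'w) graded_algebra_scheme \<Rightarrow> ('a \<Rightarrow> 'b) set"
  where "graded_algebra_iso F S A A' =
    {h \<in> ring_iso A A'.
      (\<forall>r\<in>carrier F. \<forall>a\<in>carrier A. h (r \<odot>\<^bsub>A\<^esub> a) = r \<odot>\<^bsub>A'\<^esub> h a) \<and>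
      (\<forall>s\<in>carrier S. h ` hom_part A s = hom_part A' s)}"

definition graded_isomorphic ::
  "('f, 'x) ring_scheme \<Rightarrow> ('s, 'y) monoid_scheme \<Rightarrow>
    ('f, 'a, 's, 'z) graded_algebra_scheme \<Rightarrow> ('f, 'b, 's, 'w) graded_algebra_scheme \<Rightarrow> bool"
  where "graded_isomorphic F S A A' \<longleftrightarrow> graded_algebra_iso F S A A' \<noteq> {}"


section \<open>Cocycles, pairings and the Yamazaki factorization\<close>

text \<open>
  Cocycles and pairings are taken extensional (undefined outside the carriers), so that equality of
  such maps is HOL equality. For a field \<open>F\<close>, \<open>Units F\<close> is the multiplicative group of \<open>F\<close>.
\<close>

definition cocycles :: "('f, 'x) ring_scheme \<Rightarrow> ('s, 'y) monoid_scheme \<Rightarrow> ('s \<times> 's \<Rightarrow> 'f) set"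
  where "cocycles F S =
    {\<mu> \<in> carrier S \<times> carrier S \<rightarrow>\<^sub>E Units F.
      (\<forall>x\<in>carrier S. \<forall>y\<in>carrier S. \<forall>z\<in>carrier S.
        \<mu> (x, y \<otimes>\<^bsub>S\<^esub> z) \<otimes>\<^bsub>F\<^esub> \<mu> (y, z) = \<mu> (x, y) \<otimes>\<^bsub>F\<^esub> \<mu> (x \<otimes>\<^bsub>S\<^esub> y, z)) \<and>
      (\<forall>x\<in>carrier S. \<mu> (x, \<one>\<^bsub>S\<^esub>) = \<one>\<^bsub>F\<^esub> \<and> \<mu> (\<one>\<^bsub>S\<^esub>, x) = \<one>\<^bsub>F\<^esub>)}"

definition pairings ::
  "('f, 'x) ring_scheme \<Rightarrow> ('s, 'y) monoid_scheme \<Rightarrow> ('t, 'z) monoid_scheme \<Rightarrow> ('s \<times> 't \<Rightarrow> 'f) set"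
  where "pairings F S T =
    {\<alpha> \<in> carrier S \<times> carrier T \<rightarrow>\<^sub>E Units F.
      (\<forall>s\<in>carrier S. \<forall>s'\<in>carrier S. \<forall>t\<in>carrier T.
        \<alpha> (s \<otimes>\<^bsub>S\<^esub> s', t) = \<alpha> (s, t) \<otimes>\<^bsub>F\<^esub> \<alpha> (s', t)) \<and>
      (\<forall>s\<in>carrier S. \<forall>t\<in>carrier T. \<forall>t'\<in>carrier T.
        \<alpha> (s, t \<otimes>\<^bsub>T\<^esub> t') = \<alpha> (s, t) \<otimes>\<^bsub>F\<^esub> \<alpha> (s, t'))}"

definition pairing_inv ::
  "('f, 'x) ring_scheme \<Rightarrow> ('s, 'y) monoid_scheme \<Rightarrow> ('t, 'z) monoid_scheme \<Rightarrow>
    ('s \<times> 't \<Rightarrow> 'f) \<Rightarrow> 's \<times> 't \<Rightarrow> 'f"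
  where "pairing_inv F S T \<alpha> = (\<lambda>p\<in>carrier S \<times> carrier T. inv\<^bsub>F\<^esub> (\<alpha> p))"

definition yamazaki ::
  "('f, 'x) ring_scheme \<Rightarrow> ('s, 'y) monoid_scheme \<Rightarrow> ('t, 'z) monoid_scheme \<Rightarrow>
    (('s \<times> 't) \<times> ('s \<times> 't) \<Rightarrow> 'f) \<Rightarrow> ('s \<times> 's \<Rightarrow> 'f) \<times> ('t \<times> 't \<Rightarrow> 'f) \<times> ('s \<times> 't \<Rightarrow> 'f)"
  where "yamazaki F S T \<mu> =
    (\<lambda>(s, s')\<in>carrier S \<times> carrier S. \<mu> ((s, \<one>\<^bsub>T\<^esub>), (s', \<one>\<^bsub>T\<^esub>)),
     \<lambda>(t, t')\<in>carrier T \<times> carrier T. \<mu> ((\<one>\<^bsub>S\<^esub>, t), (\<one>\<^bsub>S\<^esub>, t')),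
     \<lambda>(s, t)\<in>carrier S \<times> carrier T.
       \<mu> ((s, \<one>\<^bsub>T\<^esub>), (\<one>\<^bsub>S\<^esub>, t)) \<otimes>\<^bsub>F\<^esub> inv\<^bsub>F\<^esub> (\<mu> ((\<one>\<^bsub>S\<^esub>, t), (s, \<one>\<^bsub>T\<^esub>))))"


section \<open>Twists by a cocycle\<close>

text \<open>The bilinear extension of \<open>a * b = \<mu>(x, y) ab\<close> for \<open>a\<close>, \<open>b\<close> homogeneous of degrees \<open>x\<close>, \<open>y\<close>.\<close>

definition twist ::
  "('s, 'y) monoid_scheme \<Rightarrow> ('f, 'a, 's) graded_algebra \<Rightarrow> ('s \<times> 's \<Rightarrow> 'f) \<Rightarrow>
    ('f, 'a, 's) graded_algebra"
  where "twist S A \<mu> = A\<lparr>mult := \<lambda>a b.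
    \<Oplus>\<^bsub>A\<^esub> x \<in> hom_supp S A a. \<Oplus>\<^bsub>A\<^esub> y \<in> hom_supp S A b.
      \<mu> (x, y) \<odot>\<^bsub>A\<^esub> (hom_comp S A a x \<otimes>\<^bsub>A\<^esub> hom_comp S A b y)\<rparr>"


section \<open>Tensor products\<close>

text \<open>
  The module locale ignores the fields \<^const>\<open>mult\<close> and \<^const>\<open>one\<close>, which are left undefined in
  records that are only used as modules.
\<close>

definition free_module :: "('f, 'x) ring_scheme \<Rightarrow> 'i set \<Rightarrow> ('f, 'i \<Rightarrow> 'f) module"
  where "free_module F I =
    \<lparr>carrier = {f. (\<forall>i\<in>I. f i \<in> carrier F) \<and> (\<forall>i. i \<notin> I \<longrightarrow> f i = \<zero>\<^bsub>F\<^esub>) \<and> finite {i. f i \<noteq> \<zero>\<^bsub>F\<^esub>}},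
     mult = undefined, one = undefined,
     zero = (\<lambda>_. \<zero>\<^bsub>F\<^esub>), add = (\<lambda>f g i. f i \<oplus>\<^bsub>F\<^esub> g i), smult = (\<lambda>r f i. r \<otimes>\<^bsub>F\<^esub> f i)\<rparr>"

definition free_gen :: "('f, 'x) ring_scheme \<Rightarrow> 'i \<Rightarrow> 'i \<Rightarrow> 'f"
  where "free_gen F i = (\<lambda>j. if j = i then \<one>\<^bsub>F\<^esub> else \<zero>\<^bsub>F\<^esub>)"

definition module_span :: "('f, 'x) ring_scheme \<Rightarrow> ('f, 'a, 'z) module_scheme \<Rightarrow> 'a set \<Rightarrow> 'a set"
  where "module_span F M X = \<Inter>{N. submodule N F M \<and> X \<subseteq> N}"

definition quotient_module ::
  "('f, 'x) ring_scheme \<Rightarrow> ('f, 'a, 'z) module_scheme \<Rightarrow> 'a set \<Rightarrow> ('f, 'a set) module"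
  where "quotient_module F M N =
    \<lparr>carrier = a_rcosets\<^bsub>M\<^esub> N, mult = undefined, one = undefined,
     zero = N, add = set_add M, smult = (\<lambda>r X. \<Union>x\<in>X. N +>\<^bsub>M\<^esub> (r \<odot>\<^bsub>M\<^esub> x))\<rparr>"

definition tensor_rels ::
  "('f, 'x) ring_scheme \<Rightarrow> ('f, 'b, 'y) module_scheme \<Rightarrow> ('f, 'c, 'z) module_scheme \<Rightarrow>
    ('b \<times> 'c \<Rightarrow> 'f) set"
  where "tensor_rels F B C =
    (let M = free_module F (carrier B \<times> carrier C); g = free_gen F in
      {g (b \<oplus>\<^bsub>B\<^esub> b', c) \<ominus>\<^bsub>M\<^esub> (g (b, c) \<oplus>\<^bsub>M\<^esub> g (b', c)) | b b' c.
          b \<in> carrier B \<and> b' \<in> carrier B \<and> c \<in> carrier C} \<union>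
      {g (b, c \<oplus>\<^bsub>C\<^esub> c') \<ominus>\<^bsub>M\<^esub> (g (b, c) \<oplus>\<^bsub>M\<^esub> g (b, c')) | b c c'.
          b \<in> carrier B \<and> c \<in> carrier C \<and> c' \<in> carrier C} \<union>
      {g (r \<odot>\<^bsub>B\<^esub> b, c) \<ominus>\<^bsub>M\<^esub> r \<odot>\<^bsub>M\<^esub> g (b, c) | r b c.
          r \<in> carrier F \<and> b \<in> carrier B \<and> c \<in> carrier C} \<union>
      {g (b, r \<odot>\<^bsub>C\<^esub> c) \<ominus>\<^bsub>M\<^esub> r \<odot>\<^bsub>M\<^esub> g (b, c) | r b c.
          r \<in> carrier F \<and> b \<in> carrier B \<and> c \<in> carrier C})"

definition tensor_kernel ::
  "('f, 'x) ring_scheme \<Rightarrow> ('f, 'b, 'y) module_scheme \<Rightarrow> ('f, 'c, 'z) module_scheme \<Rightarrow>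
    ('b \<times> 'c \<Rightarrow> 'f) set"
  where "tensor_kernel F B C =
    module_span F (free_module F (carrier B \<times> carrier C)) (tensor_rels F B C)"

definition tensor_module ::
  "('f, 'x) ring_scheme \<Rightarrow> ('f, 'b, 'y) module_scheme \<Rightarrow> ('f, 'c, 'z) module_scheme \<Rightarrow>
    ('f, ('b \<times> 'c \<Rightarrow> 'f) set) module"
  where "tensor_module F B C =
    quotient_module F (free_module F (carrier B \<times> carrier C)) (tensor_kernel F B C)"

definition pure_tensor ::
  "('f, 'x) ring_scheme \<Rightarrow> ('f, 'b, 'y) module_scheme \<Rightarrow> ('f, 'c, 'z) module_scheme \<Rightarrow>
    'b \<Rightarrow> 'c \<Rightarrow> ('b \<times> 'c \<Rightarrow> 'f) set"
  where "pure_tensor F B C b c =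
    tensor_kernel F B C +>\<^bsub>free_module F (carrier B \<times> carrier C)\<^esub> free_gen F (b, c)"

text \<open>
  The bilinear extension to the tensor product of a rule \<open>P\<close> for multiplying two pure tensors
  \<open>b \<otimes> c\<close> and \<open>b' \<otimes> c'\<close> (given as pairs). As for \<^const>\<open>rcoset_mult\<close>, the union runs over
  all representatives \<open>f\<close>, \<open>g\<close> of the cosets \<open>X\<close>, \<open>Y\<close>; when \<open>P\<close> is multilinear, the summed
  coset does not depend on their choice and is the value of the union.
\<close>

definition tensor_mult ::
  "('f, 'x) ring_scheme \<Rightarrow> ('f, 'b, 'y) module_scheme \<Rightarrow> ('f, 'c, 'z) module_scheme \<Rightarrow>
    ('b \<times> 'c \<Rightarrow> 'b \<times> 'c \<Rightarrow> ('b \<times> 'c \<Rightarrow> 'f) set) \<Rightarrow>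
    ('b \<times> 'c \<Rightarrow> 'f) set \<Rightarrow> ('b \<times> 'c \<Rightarrow> 'f) set \<Rightarrow> ('b \<times> 'c \<Rightarrow> 'f) set"
  where "tensor_mult F B C P X Y =
    (let M = tensor_module F B C in
      \<Union>f\<in>X. \<Union>g\<in>Y.
        \<Oplus>\<^bsub>M\<^esub> p \<in> {p. f p \<noteq> \<zero>\<^bsub>F\<^esub>}. \<Oplus>\<^bsub>M\<^esub> q \<in> {q. g q \<noteq> \<zero>\<^bsub>F\<^esub>}.
          (f p \<otimes>\<^bsub>F\<^esub> g q) \<odot>\<^bsub>M\<^esub> P p q)"

definition graded_tensor ::
  "('f, 'x) ring_scheme \<Rightarrow> ('f, 'b, 's) graded_algebra \<Rightarrow> ('f, 'c, 't) graded_algebra \<Rightarrow>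
    ('b \<times> 'c \<Rightarrow> 'b \<times> 'c \<Rightarrow> ('b \<times> 'c \<Rightarrow> 'f) set) \<Rightarrow>
    ('f, ('b \<times> 'c \<Rightarrow> 'f) set, 's \<times> 't) graded_algebra"
  where "graded_tensor F B C P =
    (let M = tensor_module F B C in
      \<lparr>carrier = carrier M, mult = tensor_mult F B C P, one = pure_tensor F B C \<one>\<^bsub>B\<^esub> \<one>\<^bsub>C\<^esub>,
       zero = \<zero>\<^bsub>M\<^esub>, add = add M, smult = smult M,
       hom_part = (\<lambda>(s, t). module_span F M
         {pure_tensor F B C b c | b c. b \<in> hom_part B s \<and> c \<in> hom_part C t})\<rparr>)"

definition tensor_algebra ::
  "('f, 'x) ring_scheme \<Rightarrow> ('f, 'b, 's) graded_algebra \<Rightarrow> ('f, 'c, 't) graded_algebra \<Rightarrow>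
    ('f, ('b \<times> 'c \<Rightarrow> 'f) set, 's \<times> 't) graded_algebra"
  where "tensor_algebra F B C =
    graded_tensor F B C (\<lambda>(b, c) (b', c'). pure_tensor F B C (b \<otimes>\<^bsub>B\<^esub> b') (c \<otimes>\<^bsub>C\<^esub> c'))"

text \<open>
  The product of \<open>b \<otimes> c\<close> and \<open>b' \<otimes> c'\<close> is \<open>\<alpha>(s, t) bb' \<otimes> cc'\<close> if \<open>b'\<close> and \<open>c\<close> are
  homogeneous of degrees \<open>s\<close> and \<open>t\<close>; in general \<open>b'\<close> and \<open>c\<close> are decomposed first.
\<close>

definition twisted_tensor ::
  "('f, 'x) ring_scheme \<Rightarrow> ('s, 'y) monoid_scheme \<Rightarrow> ('t, 'z) monoid_scheme \<Rightarrow>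
    ('f, 'b, 's) graded_algebra \<Rightarrow> ('f, 'c, 't) graded_algebra \<Rightarrow> ('s \<times> 't \<Rightarrow> 'f) \<Rightarrow>
    ('f, ('b \<times> 'c \<Rightarrow> 'f) set, 's \<times> 't) graded_algebra"
  where "twisted_tensor F S T B C \<alpha> =
    graded_tensor F B C (\<lambda>(b, c) (b', c').
      \<Oplus>\<^bsub>tensor_module F B C\<^esub> s \<in> hom_supp S B b'. \<Oplus>\<^bsub>tensor_module F B C\<^esub> t \<in> hom_supp T C c.
        \<alpha> (s, t) \<odot>\<^bsub>tensor_module F B C\<^esub>
          pure_tensor F B C (b \<otimes>\<^bsub>B\<^esub> hom_comp S B b' s) (hom_comp T C c t \<otimes>\<^bsub>C\<^esub> c'))"

end

theory Submission
  imports Defs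
begin

text \<open>
  Both algebras live on the same graded vector space. The isomorphism multiplies the part of degree
  \<open>(s, t)\<close> by the inverse of \<open>\<gamma>(s, t) = \<mu>((s, e), (e, t))\<close>: inside the twist by \<open>\<mu>\<close> one has
  \<open>(b \<otimes> 1) * (1 \<otimes> c) = \<gamma>(s, t) (b \<otimes> c)\<close>, so this is the map sending the twisted product of \<open>b\<close> and
  \<open>c\<close> to \<open>b \<otimes> c\<close>. Multiplicativity need only be checked on homogeneous pure tensors, where it
  amounts to the identity
  \<open>\<gamma>(s, t) \<gamma>(s', t') \<mu>((s, t), (s', t')) = \<alpha>(s', t) \<nu>(s, s') \<xi>(t, t') \<gamma>(ss', tt')\<close>,
  obtained by reordering the product \<open>(s, e) (e, t) (s', e) (e, t')\<close> with the cocycle equation.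
\<close>

subsection \<open>Modules and submodules\<close>

text \<open>The obstacle is that neither product is visibly bilinear. A tensor is a coset of
  finitely supported functions; \<open>tensor_mult\<close> is a union over all pairs of
  representatives, and \<open>twist\<close> sums over supports that vary with the arguments and come
  from the unique decomposition in \<open>direct_sum\<close>. Checking on homogeneous pure tensors
  is conclusive only once both products are known to be bilinear, and the product of the twist has
  its intended value only once the tensor product is known to be graded. Both facts rest on the
  universal property of the tensor product, stated so as to cover every representative of a coset.
  What remains is an equality of scalars. It holds because (e, t) and (s', e) commute in S \<times>
  T, while the values of \<mu> on the two orders differ by exactly \<alpha>(s', t), according to the
  third component of the factorization. As an isomorphism is a bijection compatible with linear
  structure, product, unit and degrees, source and target are treated as graded modules carrying a
  bilinear product.\<close>

lemma finsum_change:
  assumes "carrier M = carrier N" and "add M = add N" and "zero M = zero N"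
  shows "finsum M f A = finsum N f A"
  using assms by (simp add: finsum_def finprod_def)

text \<open>Such transfer lemmas serve records that share their linear structure and differ in other
  fields: an algebra and its twist, or a \<open>graded_tensor\<close> and the
  \<open>tensor_module\<close> below it.\<close>

lemma module_change:
  assumes "module F M"
    and "carrier N = carrier M" and "add N = add M" and "zero N = zero M" and "smult N = smult M"
  shows "module F N"
proof -
  interpret M: module F M by fact
  show ?thesis
  proof (rule moduleI)
    show "abelian_group N"
    proof (rule abelian_groupI)
      fix x assume "x \<in> carrier N"
      then show "\<exists>y\<in>carrier N. y \<oplus>\<^bsub>N\<^esub> x = \<zero>\<^bsub>N\<^esub>"
        using M.l_neg[of x] M.a_inv_closed[of x] by (auto simp: assms(2-))
    qed (simp_all add: assms(2-) M.a_assoc M.a_comm M.a_lcomm)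
  qed (simp_all add: assms(2-) M.is_cring M.smult_l_distr M.smult_r_distr M.smult_assoc1)
qed

lemma submodule_change:
  assumes "carrier N = carrier M" and "add N = add M" and "zero N = zero M" and "smult N = smult M"
  shows "submodule H F N \<longleftrightarrow> submodule H F M"
  using assms
  unfolding submodule_def subgroup_def submodule_axioms_def m_inv_def by simp

lemma (in module) submodule_finsum_closed:
  assumes "submodule H R M" and "\<And>i. i \<in> I \<Longrightarrow> f i \<in> H"
  shows "finsum M f I \<in> H"
proof (cases "finite I")
  case True
  then show ?thesis using assms(2)
  proof (induction I)
    case empty
    then show ?case using assms(1) by (simp add: submodule_def subgroup_def)
  next
    case (insert i I)
    moreover have "f \<in> insert i I \<rightarrow> carrier M"
      using insert.prems submoduleE(1)[OF assms(1)] by blast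
    ultimately show ?case using submoduleE(5)[OF assms(1)] by (simp add: Pi_iff)
  qed
next
  \<comment> \<open>A sum over an infinite set has the default value zero, which lies in
    \<open>H\<close>.\<close>
  case False
  then show ?thesis using assms(1) by (simp add: submodule_def subgroup_def)
qed

text \<open>Closure under negation comes for free, since -a is the multiple of a by -1.\<close>

lemma (in module) submoduleI':
  assumes "H \<subseteq> carrier M" and "\<zero>\<^bsub>M\<^esub> \<in> H"
    and "\<And>a b. \<lbrakk>a \<in> H; b \<in> H\<rbrakk> \<Longrightarrow> a \<oplus>\<^bsub>M\<^esub> b \<in> H"
    and "\<And>r a. \<lbrakk>r \<in> carrier R; a \<in> H\<rbrakk> \<Longrightarrow> r \<odot>\<^bsub>M\<^esub> a \<in> H"
  shows "submodule H R M"
proof (rule submoduleI)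
  fix a assume "a \<in> H"
  then have "\<ominus>\<^bsub>M\<^esub> a = (\<ominus> \<one>) \<odot>\<^bsub>M\<^esub> a" using assms(1) smult_l_minus[of \<one> a] by auto
  then show "\<ominus>\<^bsub>M\<^esub> a \<in> H" using assms(4) \<open>a \<in> H\<close> by simp
qed (use assms in auto)

lemma module_span_minimal:
  assumes "submodule H F M" and "X \<subseteq> H"
  shows "module_span F M X \<subseteq> H"
  using assms by (auto simp: module_span_def)

lemma module_span_superset: "X \<subseteq> module_span F M X"
  by (auto simp: module_span_def)

lemma (in module) module_span_submodule:
  assumes "X \<subseteq> carrier M"
  shows "submodule (module_span R M X) R M"
proof (rule submoduleI')
  show "module_span R M X \<subseteq> carrier M"
    using module_span_minimal[OF carrier_is_submodule assms] .
  show "\<zero>\<^bsub>M\<^esub> \<in> module_span R M X"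
    by (auto simp: module_span_def submodule_def subgroup_def)
next
  fix a b assume "a \<in> module_span R M X" "b \<in> module_span R M X"
  then show "a \<oplus>\<^bsub>M\<^esub> b \<in> module_span R M X"
    using submoduleE(5) by (auto simp: module_span_def)
next
  fix r a assume "r \<in> carrier R" "a \<in> module_span R M X"
  then show "r \<odot>\<^bsub>M\<^esub> a \<in> module_span R M X"
    using submoduleE(4) by (auto simp: module_span_def)
qed

subsection \<open>Linear and bilinear maps\<close>

text \<open>Only \<open>carrier\<close>, \<open>add\<close> and \<open>smult\<close> are read, so
  the set stays the same when an algebra is replaced by its twist. Values outside the carrier are
  unconstrained; equality of such maps is therefore always asserted pointwise on the
  carrier.\<close>

definition linear_maps ::
  "('f, 'x) ring_scheme \<Rightarrow> ('f, 'a, 'y) module_scheme \<Rightarrow> ('f, 'b, 'z) module_scheme \<Rightarrow> ('a \<Rightarrow> 'b) set"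
  where "linear_maps F M N =
    {h \<in> carrier M \<rightarrow> carrier N.
      (\<forall>x\<in>carrier M. \<forall>y\<in>carrier M. h (x \<oplus>\<^bsub>M\<^esub> y) = h x \<oplus>\<^bsub>N\<^esub> h y) \<and>
      (\<forall>r\<in>carrier F. \<forall>x\<in>carrier M. h (r \<odot>\<^bsub>M\<^esub> x) = r \<odot>\<^bsub>N\<^esub> h x)}"

text \<open>Maps are curried so that the field \<open>mult\<close> of a record can itself be a
  member.\<close>

definition bilinear_maps ::
  "('f, 'x) ring_scheme \<Rightarrow> ('f, 'a, 'y) module_scheme \<Rightarrow> ('f, 'b, 'z) module_scheme \<Rightarrow>
    ('f, 'c, 'w) module_scheme \<Rightarrow> ('a \<Rightarrow> 'b \<Rightarrow> 'c) set"
  where "bilinear_maps F M N Q =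
    {m. (\<forall>x\<in>carrier M. m x \<in> linear_maps F N Q) \<and>
        (\<forall>y\<in>carrier N. (\<lambda>x. m x y) \<in> linear_maps F M Q)}"

lemma linear_mapsI:
  assumes "\<And>x. x \<in> carrier M \<Longrightarrow> h x \<in> carrier N"
    and "\<And>x y. \<lbrakk>x \<in> carrier M; y \<in> carrier M\<rbrakk> \<Longrightarrow> h (x \<oplus>\<^bsub>M\<^esub> y) = h x \<oplus>\<^bsub>N\<^esub> h y"
    and "\<And>r x. \<lbrakk>r \<in> carrier F; x \<in> carrier M\<rbrakk> \<Longrightarrow> h (r \<odot>\<^bsub>M\<^esub> x) = r \<odot>\<^bsub>N\<^esub> h x"
  shows "h \<in> linear_maps F M N"
  using assms by (simp add: linear_maps_def)

lemma linear_mapsD: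
  assumes "h \<in> linear_maps F M N"
  shows linear_maps_closed: "x \<in> carrier M \<Longrightarrow> h x \<in> carrier N"
    and linear_maps_add: "\<lbrakk>x \<in> carrier M; y \<in> carrier M\<rbrakk> \<Longrightarrow> h (x \<oplus>\<^bsub>M\<^esub> y) = h x \<oplus>\<^bsub>N\<^esub> h y"
    and linear_maps_smult: "\<lbrakk>r \<in> carrier F; x \<in> carrier M\<rbrakk> \<Longrightarrow> h (r \<odot>\<^bsub>M\<^esub> x) = r \<odot>\<^bsub>N\<^esub> h x"
  using assms by (auto simp: linear_maps_def)

lemma linear_maps_zero:
  assumes "module F M" and "module F N" and "h \<in> linear_maps F M N"
  shows "h \<zero>\<^bsub>M\<^esub> = \<zero>\<^bsub>N\<^esub>"
proof -
  interpret M: module F M by fact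
  interpret N: module F N by fact
  have "h (\<zero>\<^bsub>F\<^esub> \<odot>\<^bsub>M\<^esub> \<zero>\<^bsub>M\<^esub>) = \<zero>\<^bsub>F\<^esub> \<odot>\<^bsub>N\<^esub> h \<zero>\<^bsub>M\<^esub>"
    by (rule linear_maps_smult[OF assms(3)]) simp_all
  then show ?thesis using assms(3) by (simp add: linear_maps_closed)
qed

lemma linear_maps_a_inv:
  assumes "module F M" and "module F N" and "h \<in> linear_maps F M N" and "x \<in> carrier M"
  shows "h (\<ominus>\<^bsub>M\<^esub> x) = \<ominus>\<^bsub>N\<^esub> h x"
proof -
  interpret M: module F M by fact
  interpret N: module F N by fact
  have "h x \<oplus>\<^bsub>N\<^esub> h (\<ominus>\<^bsub>M\<^esub> x) = \<zero>\<^bsub>N\<^esub>"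
    using linear_maps_add[OF assms(3) assms(4) M.a_inv_closed[OF assms(4)]] assms
    by (simp add: M.r_neg linear_maps_zero)
  then show ?thesis using assms(3,4) 
    by (metis M.a_inv_closed N.add.inv_equality N.a_comm linear_maps_closed)
qed

lemma linear_maps_finsum:
  assumes "module F M" and "module F N" and "h \<in> linear_maps F M N"
    and "\<And>i. i \<in> I \<Longrightarrow> f i \<in> carrier M"
  shows "h (\<Oplus>\<^bsub>M\<^esub>i\<in>I. f i) = (\<Oplus>\<^bsub>N\<^esub>i\<in>I. h (f i))"
proof -
  interpret M: module F M by fact
  interpret N: module F N by fact
  show ?thesis
  proof (cases "finite I")
    case True
    then show ?thesis using assms(4)
    proof (induction I)
      case empty
      then show ?case by (simp add: linear_maps_zero[OF assms(1-3)])
    next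
      case (insert i I)
      then show ?case
        by (simp add: Pi_iff linear_maps_add[OF assms(3)] linear_maps_closed[OF assms(3)])
    qed
  next
    case False
    then show ?thesis by (simp add: linear_maps_zero[OF assms(1-3)])
  qed
qed

lemma linear_maps_sum:
  assumes "module F M" and "module F N" and "\<And>i. i \<in> I \<Longrightarrow> h i \<in> linear_maps F M N"
  shows "(\<lambda>x. \<Oplus>\<^bsub>N\<^esub>i\<in>I. h i x) \<in> linear_maps F M N"
proof -
  interpret M: module F M by fact
  interpret N: module F N by fact
  have cl: "\<And>x. x \<in> carrier M \<Longrightarrow> (\<lambda>i. h i x) \<in> I \<rightarrow> carrier N"
    using linear_maps_closed[OF assms(3)] by blast
  show ?thesis
  proof (rule linear_mapsI)
    fix x y assume "x \<in> carrier M" "y \<in> carrier M"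
    then have "(\<Oplus>\<^bsub>N\<^esub>i\<in>I. h i (x \<oplus>\<^bsub>M\<^esub> y)) = (\<Oplus>\<^bsub>N\<^esub>i\<in>I. h i x \<oplus>\<^bsub>N\<^esub> h i y)"
      using cl
      by (intro N.finsum_cong') (auto simp: Pi_iff linear_maps_add[OF assms(3)])
    then show "(\<Oplus>\<^bsub>N\<^esub>i\<in>I. h i (x \<oplus>\<^bsub>M\<^esub> y)) = (\<Oplus>\<^bsub>N\<^esub>i\<in>I. h i x) \<oplus>\<^bsub>N\<^esub> (\<Oplus>\<^bsub>N\<^esub>i\<in>I. h i y)"
      using \<open>x \<in> carrier M\<close> \<open>y \<in> carrier M\<close> cl by (simp add: N.finsum_addf)
  next
    fix r x assume r: "r \<in> carrier F" and x: "x \<in> carrier M"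
    have "(\<Oplus>\<^bsub>N\<^esub>i\<in>I. h i (r \<odot>\<^bsub>M\<^esub> x)) = (\<Oplus>\<^bsub>N\<^esub>i\<in>I. r \<odot>\<^bsub>N\<^esub> h i x)"
      using cl r x
      by (intro N.finsum_cong') (auto simp: Pi_iff linear_maps_smult[OF assms(3)])
    also have "\<dots> = r \<odot>\<^bsub>N\<^esub> (\<Oplus>\<^bsub>N\<^esub>i\<in>I. h i x)"
      using N.finsum_smult_ldistr[OF _ r cl[OF x]] r by (cases "finite I") simp_all
    finally show "(\<Oplus>\<^bsub>N\<^esub>i\<in>I. h i (r \<odot>\<^bsub>M\<^esub> x)) = r \<odot>\<^bsub>N\<^esub> (\<Oplus>\<^bsub>N\<^esub>i\<in>I. h i x)" .
  qed (use cl in auto)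
qed

lemma linear_maps_comp:
  assumes "h \<in> linear_maps F M N" and "k \<in> linear_maps F N Q"
  shows "(\<lambda>x. k (h x)) \<in> linear_maps F M Q"
  using assms by (auto intro!: linear_mapsI simp: linear_maps_closed linear_maps_add linear_maps_smult)

lemma linear_maps_id: "(\<lambda>x. x) \<in> linear_maps F M M"
  by (simp add: linear_maps_def)

lemma linear_maps_scale:
  assumes "module F N" and "r \<in> carrier F"
  shows "(\<lambda>x. r \<odot>\<^bsub>N\<^esub> x) \<in> linear_maps F N N"
proof -
  interpret N: module F N by fact
  show ?thesis using assms(2)
    by (auto intro!: linear_mapsI simp: N.smult_r_distr N.smult_assoc1[symmetric] N.m_comm)
qed

lemma linear_maps_const_zero:
  assumes "module F N"
  shows "(\<lambda>x. \<zero>\<^bsub>N\<^esub>) \<in> linear_maps F M N"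
proof -
  interpret N: module F N by fact
  show ?thesis by (auto intro!: linear_mapsI)
qed

text \<open>This is the engine of every reduction to generators: once the set on which two linear
  maps agree is a submodule, it contains the span of any set of generators on which they
  agree.\<close>

lemma submodule_equalizer:
  assumes "module F M" and "module F N" and "h \<in> linear_maps F M N" and "k \<in> linear_maps F M N"
  shows "submodule {x \<in> carrier M. h x = k x} F M"
proof -
  interpret M: module F M by fact
  show ?thesis using assms
    by (intro M.submoduleI') (auto simp: linear_maps_zero linear_maps_add linear_maps_smult)
qed

text \<open>The counterpart of \<open>submodule_equalizer\<close> for membership claims. Applied to
  a bilinear map with one argument fixed, it propagates a claim through one tensor factor at a
  time.\<close>

lemma submodule_vimage:
  assumes "module F M" and "module F N" and "h \<in> linear_maps F M N" and "submodule H F N"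
  shows "submodule {x \<in> carrier M. h x \<in> H} F M"
proof -
  interpret M: module F M by fact
  interpret N: module F N by fact
  have "\<zero>\<^bsub>N\<^esub> \<in> H" using assms(4) by (simp add: submodule_def subgroup_def)
  then show ?thesis using assms N.submoduleE(4,5)[OF assms(4)]
    by (intro M.submoduleI') (auto simp: linear_maps_zero linear_maps_add linear_maps_smult)
qed

section \<open>Bilinear maps\<close>

lemma bilinear_mapsI:
  assumes "\<And>x. x \<in> carrier M \<Longrightarrow> m x \<in> linear_maps F N Q"
    and "\<And>y. y \<in> carrier N \<Longrightarrow> (\<lambda>x. m x y) \<in> linear_maps F M Q"
  shows "m \<in> bilinear_maps F M N Q"
  using assms by (simp add: bilinear_maps_def)

lemma bilinear_mapsD:
  assumes "m \<in> bilinear_maps F M N Q"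
  shows bilinear_maps_right: "x \<in> carrier M \<Longrightarrow> m x \<in> linear_maps F N Q"
    and bilinear_maps_left: "y \<in> carrier N \<Longrightarrow> (\<lambda>x. m x y) \<in> linear_maps F M Q"
  using assms by (auto simp: bilinear_maps_def)

lemma bilinear_maps_closed:
  assumes "m \<in> bilinear_maps F M N Q" and "x \<in> carrier M" and "y \<in> carrier N"
  shows "m x y \<in> carrier Q"
  using linear_maps_closed[OF bilinear_maps_right[OF assms(1,2)] assms(3)] .

lemma bilinear_maps_comp:
  assumes "m \<in> bilinear_maps F M N Q"
    and "h \<in> linear_maps F M' M" and "k \<in> linear_maps F N' N" and "l \<in> linear_maps F Q Q'"
  shows "(\<lambda>x y. l (m (h x) (k y))) \<in> bilinear_maps F M' N' Q'"
proof (rule bilinear_mapsI)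
  fix x assume "x \<in> carrier M'"
  then have "m (h x) \<in> linear_maps F N Q"
    by (rule bilinear_maps_right[OF assms(1) linear_maps_closed[OF assms(2)]])
  from linear_maps_comp[OF linear_maps_comp[OF assms(3) this] assms(4)]
  show "(\<lambda>y. l (m (h x) (k y))) \<in> linear_maps F N' Q'" .
next
  fix y assume "y \<in> carrier N'"
  then have "(\<lambda>x. m x (k y)) \<in> linear_maps F M Q"
    by (rule bilinear_maps_left[OF assms(1) linear_maps_closed[OF assms(3)]])
  from linear_maps_comp[OF linear_maps_comp[OF assms(2) this] assms(4)]
  show "(\<lambda>x. l (m (h x) (k y))) \<in> linear_maps F M' Q'" .
qed

lemma bilinear_maps_sum:
  assumes "module F M" and "module F N" and "module F Q"
    and "\<And>i. i \<in> I \<Longrightarrow> m i \<in> bilinear_maps F M N Q"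
  shows "(\<lambda>x y. \<Oplus>\<^bsub>Q\<^esub>i\<in>I. m i x y) \<in> bilinear_maps F M N Q"
  using assms
  by (intro bilinear_mapsI linear_maps_sum) (auto intro: bilinear_maps_right bilinear_maps_left)

text \<open>The module axioms keep sums and multiples of elements of the carrier inside it, where h
  and k agree.\<close>

lemma linear_maps_cong:
  assumes "module F M" and "\<And>x. x \<in> carrier M \<Longrightarrow> h x = k x"
  shows "h \<in> linear_maps F M N \<longleftrightarrow> k \<in> linear_maps F M N"
proof -
  interpret M: module F M by fact
  show ?thesis using assms(2) by (auto simp: linear_maps_def Pi_iff)
qed

lemma linear_maps_change:
  assumes "carrier M' = carrier M" and "add M' = add M" and "smult M' = smult M"
    and "carrier N' = carrier N" and "add N' = add N" and "smult N' = smult N"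
  shows "linear_maps F M' N' = linear_maps F M N"
  using assms by (simp add: linear_maps_def)

lemma bilinear_maps_change:
  assumes "carrier M' = carrier M" and "add M' = add M" and "smult M' = smult M"
    and "carrier N' = carrier N" and "add N' = add N" and "smult N' = smult N"
    and "carrier Q' = carrier Q" and "add Q' = add Q" and "smult Q' = smult Q"
  shows "bilinear_maps F M' N' Q' = bilinear_maps F M N Q"
  using assms by (simp add: bilinear_maps_def linear_maps_def)

lemma bilinear_maps_scale:
  assumes "module F Q" and "m \<in> bilinear_maps F M N Q" and "r \<in> carrier F"
  shows "(\<lambda>x y. r \<odot>\<^bsub>Q\<^esub> m x y) \<in> bilinear_maps F M N Q"
  by (rule bilinear_maps_comp[OF assms(2) linear_maps_id linear_maps_id
        linear_maps_scale[OF assms(1,3)]])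

subsection \<open>Graded modules\<close>

text \<open>The linear half of \<open>graded_algebra\<close>. Tensor products and twists can be
  placed here without first establishing ring axioms for their products; where a product matters,
  its bilinearity is passed separately.\<close>

locale graded_module = module F A
  for F :: "('f, 'x) ring_scheme" (structure)
    and S :: "('s, 'y) monoid_scheme"
    and A :: "('f, 'a, 's, 'z) graded_algebra_scheme" (structure) +
  assumes hom_part_submodule: "s \<in> carrier S \<Longrightarrow> submodule (hom_part A s) F A"
    and direct_sum: "a \<in> carrier A \<Longrightarrow> \<exists>!f. is_hom_decomp S A a f"

lemma graded_algebra_imp_graded_module:
  assumes "graded_algebra F S A"
  shows "graded_module F S A"
proof -
  interpret graded_algebra F S A by fact
  show ?thesis
    by (intro graded_module.intro graded_module_axioms.intro module_axioms)
      (fact hom_part_submodule direct_sum)+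
qed

context graded_module
begin

lemma hom_part_subset: "s \<in> carrier S \<Longrightarrow> hom_part A s \<subseteq> carrier A"
  using submoduleE(1)[OF hom_part_submodule] .

lemma zero_in_hom_part: "s \<in> carrier S \<Longrightarrow> \<zero>\<^bsub>A\<^esub> \<in> hom_part A s"
  using hom_part_submodule by (simp add: submodule_def subgroup_def)

lemma hom_decomp_hom_comp: "a \<in> carrier A \<Longrightarrow> is_hom_decomp S A a (hom_comp S A a)"
  unfolding hom_comp_def by (rule theI'[OF direct_sum])

lemma hom_comp_in_hom_part:
  "\<lbrakk>a \<in> carrier A; s \<in> carrier S\<rbrakk> \<Longrightarrow> hom_comp S A a s \<in> hom_part A s"
  using hom_decomp_hom_comp by (auto simp: is_hom_decomp_def)

lemma hom_comp_closed: "\<lbrakk>a \<in> carrier A; s \<in> carrier S\<rbrakk> \<Longrightarrow> hom_comp S A a s \<in> carrier A"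
  using hom_comp_in_hom_part hom_part_subset by blast

lemma finite_hom_supp: "a \<in> carrier A \<Longrightarrow> finite (hom_supp S A a)"
  using hom_decomp_hom_comp by (auto simp: is_hom_decomp_def hom_supp_def)

lemma hom_supp_subset: "hom_supp S A a \<subseteq> carrier S"
  by (auto simp: hom_supp_def)

lemma sum_hom_comp:
  "a \<in> carrier A \<Longrightarrow> (\<Oplus>\<^bsub>A\<^esub>s\<in>hom_supp S A a. hom_comp S A a s) = a"
  using hom_decomp_hom_comp by (simp add: is_hom_decomp_def hom_supp_def)

text \<open>The index set \<open>hom_supp S A a\<close> moves with a, which hides the linearity of
  such sums. Padding with zero terms replaces it by any larger finite set, in particular by one
  shared by several elements.\<close>

lemma sum_over_hom_supp:
  assumes "module F M" and "\<And>s. s \<in> carrier S \<Longrightarrow> g s \<in> linear_maps F A M"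
    and "a \<in> carrier A" and "finite T" and "hom_supp S A a \<subseteq> T" and "T \<subseteq> carrier S"
  shows "(\<Oplus>\<^bsub>M\<^esub>s\<in>hom_supp S A a. g s (hom_comp S A a s)) = (\<Oplus>\<^bsub>M\<^esub>s\<in>T. g s (hom_comp S A a s))"
proof -
  interpret M: module F M by fact
  have "g s (hom_comp S A a s) = \<zero>\<^bsub>M\<^esub>" if "s \<in> T - hom_supp S A a" for s
  proof -
    have s: "s \<in> carrier S" "hom_comp S A a s = \<zero>\<^bsub>A\<^esub>"
      using that assms(6) by (auto simp: hom_supp_def)
    then show ?thesis using linear_maps_zero[OF module_axioms assms(1) assms(2)[OF s(1)]] by simp
  qed
  then show ?thesis using assms(3-6) hom_supp_subset hom_comp_closed
    by (intro M.add.finprod_mono_neutral_cong_left)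
      (auto intro!: linear_maps_closed[OF assms(2)])
qed

text \<open>The uniqueness half of \<open>direct_sum\<close> in usable form. Some f s may vanish, so
  T may exceed the support of a.\<close>

lemma hom_comp_eqI:
  assumes "finite T" and "T \<subseteq> carrier S" and "\<And>s. s \<in> T \<Longrightarrow> f s \<in> hom_part A s"
    and "a = (\<Oplus>\<^bsub>A\<^esub>s\<in>T. f s)" and "s \<in> carrier S"
  shows "hom_comp S A a s = (if s \<in> T then f s else \<zero>\<^bsub>A\<^esub>)"
proof -
  \<comment> \<open>Extending f by zero, and by \<open>undefined\<close> off the carrier, gives the
    extensional shape that \<open>is_hom_decomp\<close> demands.\<close>
  define f' where "f' = (\<lambda>s\<in>carrier S. if s \<in> T then f s else \<zero>\<^bsub>A\<^esub>)"
  have T: "f s \<in> carrier A" if "s \<in> T" for s using that assms(2,3) hom_part_subset by blast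
  have sub: "{s \<in> carrier S. f' s \<noteq> \<zero>\<^bsub>A\<^esub>} \<subseteq> T" by (auto simp: f'_def)
  have "(\<Oplus>\<^bsub>A\<^esub>s\<in>{s \<in> carrier S. f' s \<noteq> \<zero>\<^bsub>A\<^esub>}. f' s) = (\<Oplus>\<^bsub>A\<^esub>s\<in>T. f s)"
    using assms(1,2) sub T
    by (intro M.add.finprod_mono_neutral_cong_left) (auto simp: f'_def)
  then have dec: "is_hom_decomp S A a f'"
    using assms sub zero_in_hom_part finite_subset[OF sub assms(1)]
    by (auto simp: is_hom_decomp_def f'_def)
  have "a \<in> carrier A" using assms(4) T by (simp add: Pi_iff)
  then have "hom_comp S A a = f'"
    using direct_sum dec hom_decomp_hom_comp by blast
  then show ?thesis using assms(5) by (simp add: f'_def)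
qed

lemma hom_comp_homogeneous:
  assumes "s \<in> carrier S" and "t \<in> carrier S" and "a \<in> hom_part A s"
  shows "hom_comp S A a t = (if t = s then a else \<zero>\<^bsub>A\<^esub>)"
  using hom_comp_eqI[of "{s}" "\<lambda>_. a" a t] assms hom_part_subset[OF assms(1)]
  by (auto simp: Pi_iff)

text \<open>Adding the components of a and b degree by degree over the union of their supports
  decomposes the sum a + b, and decompositions are unique. Scalar multiples are treated
  alike.\<close>

lemma hom_comp_linear:
  assumes "s \<in> carrier S"
  shows "(\<lambda>a. hom_comp S A a s) \<in> linear_maps F A A"
proof (rule linear_mapsI)
  fix a b assume a: "a \<in> carrier A" and b: "b \<in> carrier A"
  let ?T = "hom_supp S A a \<union> hom_supp S A b"
  have T: "finite ?T" "?T \<subseteq> carrier S"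
    using a b finite_hom_supp hom_supp_subset by auto
  have cl: "hom_comp S A a \<in> ?T \<rightarrow> carrier A" "hom_comp S A b \<in> ?T \<rightarrow> carrier A"
    using a b T(2) hom_comp_closed by (blast intro: Pi_I)+
  have sum: "(\<Oplus>\<^bsub>A\<^esub>t\<in>?T. hom_comp S A c t) = c" if "c \<in> {a, b}" for c
    using sum_over_hom_supp[of A "\<lambda>_ x. x" c ?T] sum_hom_comp[of c] T that a b
    by (auto simp: module_axioms linear_maps_id)
  have "hom_comp S A (a \<oplus>\<^bsub>A\<^esub> b) s
      = (if s \<in> ?T then hom_comp S A a s \<oplus>\<^bsub>A\<^esub> hom_comp S A b s else \<zero>\<^bsub>A\<^esub>)"
  proof (rule hom_comp_eqI)
    show "a \<oplus>\<^bsub>A\<^esub> b = (\<Oplus>\<^bsub>A\<^esub>t\<in>?T. hom_comp S A a t \<oplus>\<^bsub>A\<^esub> hom_comp S A b t)"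
      using cl sum by (simp add: M.finsum_addf)
  next
    fix t assume "t \<in> ?T"
    then have "t \<in> carrier S" using T by blast
    then show "hom_comp S A a t \<oplus>\<^bsub>A\<^esub> hom_comp S A b t \<in> hom_part A t"
      using a b hom_comp_in_hom_part submoduleE(5)[OF hom_part_submodule] by blast
  qed (use T assms in auto)
  then show "hom_comp S A (a \<oplus>\<^bsub>A\<^esub> b) s = hom_comp S A a s \<oplus>\<^bsub>A\<^esub> hom_comp S A b s"
    using assms by (auto simp: hom_supp_def split: if_splits)
next
  fix r a assume r: "r \<in> carrier F" and a: "a \<in> carrier A"
  let ?T = "hom_supp S A a"
  have cl: "hom_comp S A a \<in> ?T \<rightarrow> carrier A"
    using a hom_supp_subset hom_comp_closed by (blast intro: Pi_I)
  have "hom_comp S A (r \<odot>\<^bsub>A\<^esub> a) s = (if s \<in> ?T then r \<odot>\<^bsub>A\<^esub> hom_comp S A a s else \<zero>\<^bsub>A\<^esub>)"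
  proof (rule hom_comp_eqI)
    show "r \<odot>\<^bsub>A\<^esub> a = (\<Oplus>\<^bsub>A\<^esub>t\<in>?T. r \<odot>\<^bsub>A\<^esub> hom_comp S A a t)"
      using finsum_smult_ldistr[OF finite_hom_supp[OF a] r cl] sum_hom_comp[OF a] by simp
  next
    fix t assume "t \<in> ?T"
    then have "t \<in> carrier S" using hom_supp_subset by blast
    then show "r \<odot>\<^bsub>A\<^esub> hom_comp S A a t \<in> hom_part A t"
      using a r hom_comp_in_hom_part submoduleE(4)[OF hom_part_submodule] by blast
  qed (use finite_hom_supp[OF a] hom_supp_subset assms in auto)
  then show "hom_comp S A (r \<odot>\<^bsub>A\<^esub> a) s = r \<odot>\<^bsub>A\<^esub> hom_comp S A a s"
    using assms r by (auto simp: hom_supp_def split: if_splits)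
qed (use assms hom_comp_closed in auto)

text \<open>Linear maps g s, one for each degree, are glued to a single map. Over a fixed index set
  the glued map is a sum of compositions with projections, hence linear; for given arguments all
  sums involved can be moved to one such set.\<close>

lemma graded_extension_linear:
  assumes "module F M" and "\<And>s. s \<in> carrier S \<Longrightarrow> g s \<in> linear_maps F A M"
  shows "(\<lambda>a. \<Oplus>\<^bsub>M\<^esub>s\<in>hom_supp S A a. g s (hom_comp S A a s)) \<in> linear_maps F A M" (is "?h \<in> _")
proof -
  interpret M: module F M by fact
  have lin: "(\<lambda>a. \<Oplus>\<^bsub>M\<^esub>s\<in>T. g s (hom_comp S A a s)) \<in> linear_maps F A M" if "T \<subseteq> carrier S" for T
    using that by (intro linear_maps_sum[OF module_axioms assms(1)]
        linear_maps_comp[OF hom_comp_linear assms(2)]) auto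
  note eq = sum_over_hom_supp[OF assms]
  show ?thesis
  proof (rule linear_mapsI)
    fix a assume a: "a \<in> carrier A"
    show "?h a \<in> carrier M" using linear_maps_closed[OF lin[OF hom_supp_subset] a] .
  next
    fix a b assume a: "a \<in> carrier A" and b: "b \<in> carrier A"
    \<comment> \<open>The support of the sum is included as well, so that all three values become
      sums over this one set, to which \<open>lin\<close> applies.\<close>
    let ?T = "hom_supp S A a \<union> hom_supp S A b \<union> hom_supp S A (a \<oplus>\<^bsub>A\<^esub> b)"
    have T: "finite ?T" "?T \<subseteq> carrier S"
      using a b finite_hom_supp hom_supp_subset by auto
    have "?h (a \<oplus>\<^bsub>A\<^esub> b) = (\<Oplus>\<^bsub>M\<^esub>s\<in>?T. g s (hom_comp S A (a \<oplus>\<^bsub>A\<^esub> b) s))"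
      "?h a = (\<Oplus>\<^bsub>M\<^esub>s\<in>?T. g s (hom_comp S A a s))" "?h b = (\<Oplus>\<^bsub>M\<^esub>s\<in>?T. g s (hom_comp S A b s))"
      using a b T by (auto intro!: eq)
    then show "?h (a \<oplus>\<^bsub>A\<^esub> b) = ?h a \<oplus>\<^bsub>M\<^esub> ?h b"
      using linear_maps_add[OF lin[OF T(2)] a b] by simp
  next
    fix r a assume r: "r \<in> carrier F" and a: "a \<in> carrier A"
    let ?T = "hom_supp S A a \<union> hom_supp S A (r \<odot>\<^bsub>A\<^esub> a)"
    have T: "finite ?T" "?T \<subseteq> carrier S"
      using r a finite_hom_supp hom_supp_subset by auto
    have "?h (r \<odot>\<^bsub>A\<^esub> a) = (\<Oplus>\<^bsub>M\<^esub>s\<in>?T. g s (hom_comp S A (r \<odot>\<^bsub>A\<^esub> a) s))"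
      "?h a = (\<Oplus>\<^bsub>M\<^esub>s\<in>?T. g s (hom_comp S A a s))"
      using r a T by (auto intro!: eq)
    then show "?h (r \<odot>\<^bsub>A\<^esub> a) = r \<odot>\<^bsub>M\<^esub> ?h a"
      using linear_maps_smult[OF lin[OF T(2)] r a] by simp
  qed
qed

lemma graded_extension_homogeneous:
  assumes "module F M" and "\<And>s. s \<in> carrier S \<Longrightarrow> g s \<in> linear_maps F A M"
    and "s \<in> carrier S" and "a \<in> hom_part A s"
  shows "(\<Oplus>\<^bsub>M\<^esub>t\<in>hom_supp S A a. g t (hom_comp S A a t)) = g s a"
proof -
  interpret M: module F M by fact
  have a: "a \<in> carrier A" using assms hom_part_subset by blast
  \<comment> \<open>Only an inclusion, since the support is empty when a is zero.\<close>
  have "hom_supp S A a \<subseteq> {s}"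
    using hom_comp_homogeneous[OF assms(3) _ assms(4)] by (auto simp: hom_supp_def split: if_splits)
  then have "(\<Oplus>\<^bsub>M\<^esub>t\<in>hom_supp S A a. g t (hom_comp S A a t)) = (\<Oplus>\<^bsub>M\<^esub>t\<in>{s}. g t (hom_comp S A a t))"
    using sum_over_hom_supp[OF assms(1,2) a] assms(3) by simp
  then show ?thesis
    using a assms(3) linear_maps_closed[OF assms(2)] hom_comp_homogeneous[OF assms(3) assms(3) assms(4)]
    by (simp add: Pi_iff)
qed

lemma homogeneous_induct:
  assumes "submodule H F A" and "\<And>s. s \<in> carrier S \<Longrightarrow> hom_part A s \<subseteq> H"
  shows "carrier A \<subseteq> H"
proof
  fix a assume a: "a \<in> carrier A"
  have "(\<Oplus>\<^bsub>A\<^esub>s\<in>hom_supp S A a. hom_comp S A a s) \<in> H"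
    using a assms(2) hom_comp_in_hom_part hom_supp_subset
    by (intro submodule_finsum_closed[OF assms(1)]) blast
  then show "a \<in> H" using a sum_hom_comp by simp
qed

lemma linear_maps_eq_on_homogeneous:
  assumes "module F M" and "h \<in> linear_maps F A M" and "k \<in> linear_maps F A M"
    and "\<And>s a. \<lbrakk>s \<in> carrier S; a \<in> hom_part A s\<rbrakk> \<Longrightarrow> h a = k a" and "a \<in> carrier A"
  shows "h a = k a"
  using homogeneous_induct[OF submodule_equalizer[OF module_axioms assms(1-3)]] assms(4,5)
    hom_part_subset by blast

end

text \<open>A family of projections onto the homogeneous parts yields a grading; unlike
  \<^const>\<open>is_hom_decomp\<close>, its hypotheses can be checked on generators.\<close>

lemma graded_moduleI:
  fixes A :: "('f, 'a, 's, 'z) graded_algebra_scheme"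
  assumes "module F A"
    and sub: "\<And>s. s \<in> carrier S \<Longrightarrow> submodule (hom_part A s) F A"
    and lin: "\<And>s. s \<in> carrier S \<Longrightarrow> p s \<in> linear_maps F A A"
    and into: "\<And>s a. \<lbrakk>s \<in> carrier S; a \<in> carrier A\<rbrakk> \<Longrightarrow> p s a \<in> hom_part A s"
    and proj: "\<And>s t a. \<lbrakk>s \<in> carrier S; t \<in> carrier S; a \<in> hom_part A s\<rbrakk> \<Longrightarrow>
      p t a = (if t = s then a else \<zero>\<^bsub>A\<^esub>)"
    and gen: "\<And>H. \<lbrakk>submodule H F A; \<And>s. s \<in> carrier S \<Longrightarrow> hom_part A s \<subseteq> H\<rbrakk> \<Longrightarrow> carrier A \<subseteq> H"
  shows "graded_module F S A"
proof (rule graded_module.intro[OF assms(1)], rule graded_module_axioms.intro[OF sub])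
  interpret module F A by fact
  fix a assume a: "a \<in> carrier A"
  let ?supp = "\<lambda>a. {s \<in> carrier S. p s a \<noteq> \<zero>\<^bsub>A\<^esub>}"
  \<comment> \<open>The elements that are recovered as a finite sum of their projections. T may be
    larger than the support, so that for the sum of two elements the union of their index sets is a
    witness.\<close>
  let ?H = "{a \<in> carrier A. \<exists>T. finite T \<and> ?supp a \<subseteq> T \<and> T \<subseteq> carrier S \<and> a = (\<Oplus>\<^bsub>A\<^esub>s\<in>T. p s a)}"
  have cl: "p s a \<in> carrier A" if "s \<in> carrier S" "a \<in> carrier A" for s a
    using linear_maps_closed[OF lin] that .
  have change: "(\<Oplus>\<^bsub>A\<^esub>s\<in>T'. p s a) = (\<Oplus>\<^bsub>A\<^esub>s\<in>T. p s a)"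
    if "a \<in> carrier A" "finite T" "T' \<subseteq> T" "T \<subseteq> carrier S" "?supp a \<subseteq> T'" for a T T'
    using that cl by (intro M.add.finprod_mono_neutral_cong_left) auto
  have lin_sum: "(\<lambda>a. \<Oplus>\<^bsub>A\<^esub>s\<in>T. p s a) \<in> linear_maps F A A" if "T \<subseteq> carrier S" for T
    using that lin by (intro linear_maps_sum module_axioms) auto
  have "submodule ?H F A"
  proof (rule submoduleI')
    show "\<zero>\<^bsub>A\<^esub> \<in> ?H"
      using linear_maps_zero[OF module_axioms module_axioms lin]
      by (auto intro!: exI[of _ "{}"])
  next
    fix a b assume "a \<in> ?H" "b \<in> ?H"
    then obtain T U where T: "a \<in> carrier A" "finite T" "?supp a \<subseteq> T" "T \<subseteq> carrier S"
        "a = (\<Oplus>\<^bsub>A\<^esub>s\<in>T. p s a)"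
      and U: "b \<in> carrier A" "finite U" "?supp b \<subseteq> U" "U \<subseteq> carrier S" "b = (\<Oplus>\<^bsub>A\<^esub>s\<in>U. p s b)"
      by auto
    have TU: "finite (T \<union> U)" "T \<union> U \<subseteq> carrier S" using T U by auto
    have "a = (\<Oplus>\<^bsub>A\<^esub>s\<in>T \<union> U. p s a)" "b = (\<Oplus>\<^bsub>A\<^esub>s\<in>T \<union> U. p s b)"
      using change[OF T(1) TU(1) _ TU(2) T(3)] change[OF U(1) TU(1) _ TU(2) U(3)] T(5) U(5) by auto
    then have "a \<oplus>\<^bsub>A\<^esub> b = (\<Oplus>\<^bsub>A\<^esub>s\<in>T \<union> U. p s (a \<oplus>\<^bsub>A\<^esub> b))"
      using linear_maps_add[OF lin_sum[OF TU(2)] T(1) U(1)] by simp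
    moreover have "?supp (a \<oplus>\<^bsub>A\<^esub> b) \<subseteq> T \<union> U"
    proof
      fix s assume "s \<in> ?supp (a \<oplus>\<^bsub>A\<^esub> b)"
      then have "s \<in> carrier S" "p s a \<oplus>\<^bsub>A\<^esub> p s b \<noteq> \<zero>\<^bsub>A\<^esub>"
        using linear_maps_add[OF lin T(1) U(1)] by auto
      then have "p s a \<noteq> \<zero>\<^bsub>A\<^esub> \<or> p s b \<noteq> \<zero>\<^bsub>A\<^esub>" by auto
      then show "s \<in> T \<union> U" using \<open>s \<in> carrier S\<close> T(3) U(3) by auto
    qed
    ultimately show "a \<oplus>\<^bsub>A\<^esub> b \<in> ?H" using TU T(1) U(1) by blast
  next
    fix r a assume r: "r \<in> carrier F" and "a \<in> ?H"
    then obtain T where T: "a \<in> carrier A" "finite T" "?supp a \<subseteq> T" "T \<subseteq> carrier S"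
        "a = (\<Oplus>\<^bsub>A\<^esub>s\<in>T. p s a)"
      by auto
    have "r \<odot>\<^bsub>A\<^esub> a = (\<Oplus>\<^bsub>A\<^esub>s\<in>T. p s (r \<odot>\<^bsub>A\<^esub> a))"
      using linear_maps_smult[OF lin_sum[OF T(4)] r T(1)] T(5) by simp
    moreover have "?supp (r \<odot>\<^bsub>A\<^esub> a) \<subseteq> T"
      using linear_maps_smult[OF lin r T(1)] T(3) r by auto
    ultimately show "r \<odot>\<^bsub>A\<^esub> a \<in> ?H" using T r by blast
  qed auto
  moreover have "hom_part A s \<subseteq> ?H" if s: "s \<in> carrier S" for s
  proof
    fix a assume a: "a \<in> hom_part A s"
    then have "a \<in> carrier A" using submoduleE(1)[OF sub[OF s]] by blast
    \<comment> \<open>The witness {s} also serves a = 0, whose support is empty.\<close>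
    then show "a \<in> ?H" using proj[OF s _ a] s
      by (auto intro!: exI[of _ "{s}"] simp: Pi_iff split: if_splits)
  qed
  ultimately have "a \<in> ?H" using gen[of ?H] a by blast
  then obtain T where T: "finite T" "?supp a \<subseteq> T" "T \<subseteq> carrier S" "a = (\<Oplus>\<^bsub>A\<^esub>s\<in>T. p s a)"
    by auto
  show "\<exists>!f. is_hom_decomp S A a f"
  proof (rule ex1I)
    have supp: "{s \<in> carrier S. (\<lambda>s\<in>carrier S. p s a) s \<noteq> \<zero>\<^bsub>A\<^esub>} = ?supp a" by auto
    have "(\<Oplus>\<^bsub>A\<^esub>s\<in>?supp a. (\<lambda>s\<in>carrier S. p s a) s) = (\<Oplus>\<^bsub>A\<^esub>s\<in>?supp a. p s a)"
      using a cl by (intro M.finsum_cong') auto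
    also have "\<dots> = a" using change[OF a T(1,2,3)] T(4) by auto
    finally have sum: "(\<Oplus>\<^bsub>A\<^esub>s\<in>?supp a. (\<lambda>s\<in>carrier S. p s a) s) = a" .
    show "is_hom_decomp S A a (\<lambda>s\<in>carrier S. p s a)"
      unfolding is_hom_decomp_def supp
      using into[OF _ a] finite_subset[OF T(2,1)] by (intro conjI sum[symmetric]) auto
  next
    fix f assume f: "is_hom_decomp S A a f"
    let ?T = "{s \<in> carrier S. f s \<noteq> \<zero>\<^bsub>A\<^esub>}"
    have f': "f \<in> (\<Pi>\<^sub>E s\<in>carrier S. hom_part A s)" "finite ?T" "a = (\<Oplus>\<^bsub>A\<^esub>s\<in>?T. f s)"
      using f by (simp_all add: is_hom_decomp_def)
    have fcl: "f s \<in> carrier A" if "s \<in> carrier S" for s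
      using f'(1) submoduleE(1)[OF sub[OF that]] that by auto
    \<comment> \<open>Uniqueness: applying the projection p t to any decomposition f leaves only its
      term of degree t.\<close>
    have "p t a = f t" if t: "t \<in> carrier S" for t
    proof -
      have "p t a = (\<Oplus>\<^bsub>A\<^esub>s\<in>?T. p t (f s))"
        using linear_maps_finsum[OF module_axioms module_axioms lin[OF t], of ?T f] fcl f'(3) by simp
      also have "\<dots> = (\<Oplus>\<^bsub>A\<^esub>s\<in>?T. if t = s then f s else \<zero>\<^bsub>A\<^esub>)"
        using fcl proj[OF _ t PiE_mem[OF f'(1)]] by (intro M.finsum_cong') auto
      also have "\<dots> = f t"
      proof (cases "t \<in> ?T")
        case True
        then show ?thesis using M.add.finprod_singleton[OF True f'(2)] fcl by auto
      next
        case False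
        then have "(\<Oplus>\<^bsub>A\<^esub>s\<in>?T. if t = s then f s else \<zero>\<^bsub>A\<^esub>) = (\<Oplus>\<^bsub>A\<^esub>s\<in>?T. \<zero>\<^bsub>A\<^esub>)"
          by (intro M.finsum_cong') auto
        then show ?thesis using False t by simp
      qed
      finally show ?thesis .
    qed
    then show "f = (\<lambda>s\<in>carrier S. p s a)"
      using f'(1) by (auto simp: PiE_def extensional_def restrict_def)
  qed
qed

text \<open>Both products under study are glued from bilinear maps that depend on a pair of degrees.
  The twist is the case where both arguments lie in the same algebra; for the twisted tensor product
  they are the inner factors b' and c of (b \<otimes> c)(b' \<otimes> c'). The proof glues in the
  second argument first and then in the first.\<close>

lemma graded_bilinear_extension:
  fixes A :: "('f, 'a, 's, 'z) graded_algebra_scheme" and A' :: "('f, 'b, 't, 'w) graded_algebra_scheme"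
  assumes "graded_module F S A" and "graded_module F T A'" and "module F M"
    and g: "\<And>s t. \<lbrakk>s \<in> carrier S; t \<in> carrier T\<rbrakk> \<Longrightarrow> g s t \<in> bilinear_maps F A A' M"
  shows "(\<lambda>a b. \<Oplus>\<^bsub>M\<^esub>s\<in>hom_supp S A a. \<Oplus>\<^bsub>M\<^esub>t\<in>hom_supp T A' b. g s t (hom_comp S A a s) (hom_comp T A' b t))
      \<in> bilinear_maps F A A' M" (is "?g \<in> _")
    and "\<lbrakk>s \<in> carrier S; t \<in> carrier T; a \<in> hom_part A s; b \<in> hom_part A' t\<rbrakk> \<Longrightarrow>
      (\<Oplus>\<^bsub>M\<^esub>s\<in>hom_supp S A a. \<Oplus>\<^bsub>M\<^esub>t\<in>hom_supp T A' b. g s t (hom_comp S A a s) (hom_comp T A' b t)) = g s t a b"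
proof -
  interpret A: graded_module F S A by fact
  interpret A': graded_module F T A' by fact
  interpret M: module F M by fact
  have inner: "(\<lambda>b. \<Oplus>\<^bsub>M\<^esub>t\<in>hom_supp T A' b. g s t a (hom_comp T A' b t)) \<in> linear_maps F A' M"
    if "s \<in> carrier S" "a \<in> carrier A" for s a
    by (rule A'.graded_extension_linear[OF M.module_axioms bilinear_maps_right[OF g[OF that(1)] that(2)]])
  have outer: "(\<lambda>a. \<Oplus>\<^bsub>M\<^esub>t\<in>hom_supp T A' b. g s t a (hom_comp T A' b t)) \<in> linear_maps F A M"
    if s: "s \<in> carrier S" and b: "b \<in> carrier A'" for s b
  proof (rule linear_maps_sum[OF A.module_axioms M.module_axioms])
    fix t assume "t \<in> hom_supp T A' b"
    then have t: "t \<in> carrier T" using A'.hom_supp_subset by blast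
    show "(\<lambda>a. g s t a (hom_comp T A' b t)) \<in> linear_maps F A M"
      by (rule bilinear_maps_left[OF g[OF s t] A'.hom_comp_closed[OF b t]])
  qed
  show "?g \<in> bilinear_maps F A A' M"
  proof (rule bilinear_mapsI)
    fix a assume a: "a \<in> carrier A"
    show "?g a \<in> linear_maps F A' M"
    proof (rule linear_maps_sum[OF A'.module_axioms M.module_axioms])
      fix s assume "s \<in> hom_supp S A a"
      then have s: "s \<in> carrier S" using A.hom_supp_subset by blast
      show "(\<lambda>b. \<Oplus>\<^bsub>M\<^esub>t\<in>hom_supp T A' b. g s t (hom_comp S A a s) (hom_comp T A' b t))
          \<in> linear_maps F A' M"
        by (rule inner[OF s A.hom_comp_closed[OF a s]])
    qed
  next
    fix b assume b: "b \<in> carrier A'"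
    show "(\<lambda>a. ?g a b) \<in> linear_maps F A M"
      by (rule A.graded_extension_linear[OF M.module_axioms outer[OF _ b]])
  qed
  assume s: "s \<in> carrier S" and t: "t \<in> carrier T" and a: "a \<in> hom_part A s" and b: "b \<in> hom_part A' t"
  have a': "a \<in> carrier A" and b': "b \<in> carrier A'"
    using A.hom_part_subset[OF s] A'.hom_part_subset[OF t] a b by blast+
  have "?g a b = (\<Oplus>\<^bsub>M\<^esub>t\<in>hom_supp T A' b. g s t a (hom_comp T A' b t))"
    by (rule A.graded_extension_homogeneous[OF M.module_axioms outer[OF _ b'] s a])
  also have "\<dots> = g s t a b"
    by (rule A'.graded_extension_homogeneous[OF M.module_axioms bilinear_maps_right[OF g[OF s] a'] t b])
  finally show "?g a b = g s t a b" .
qed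

text \<open>Scaling each degree by its own unit is an automorphism of the graded module, with the
  scaling by the inverse units as its inverse. It supplies the underlying map of the final
  isomorphism.\<close>

lemma (in graded_module) hom_part_rescaling:
  assumes \<gamma>: "\<And>s. s \<in> carrier S \<Longrightarrow> \<gamma> s \<in> Units F"
  obtains \<phi> where "\<phi> \<in> linear_maps F A A" and "bij_betw \<phi> (carrier A) (carrier A)"
    and "\<And>s a. \<lbrakk>s \<in> carrier S; a \<in> hom_part A s\<rbrakk> \<Longrightarrow> \<phi> a = \<gamma> s \<odot>\<^bsub>A\<^esub> a"
    and "\<And>s. s \<in> carrier S \<Longrightarrow> \<phi> ` hom_part A s = hom_part A s"
proof -
  \<comment> \<open>The family of scalars is a parameter, so that the facts below apply to \<gamma>
    and to its inverses, and \<open>inverse\<close> can be used in both directions.\<close>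
  define scale where
    "scale = (\<lambda>\<delta> a. \<Oplus>\<^bsub>A\<^esub>s\<in>hom_supp S A a. \<delta> s \<odot>\<^bsub>A\<^esub> hom_comp S A a s)"
  have lin: "scale \<delta> \<in> linear_maps F A A"
    if "\<And>s. s \<in> carrier S \<Longrightarrow> \<delta> s \<in> carrier F" for \<delta>
    unfolding scale_def
    by (rule graded_extension_linear[OF module_axioms linear_maps_scale[OF module_axioms that]])
  have hom: "scale \<delta> a = \<delta> s \<odot>\<^bsub>A\<^esub> a"
    if "\<And>s. s \<in> carrier S \<Longrightarrow> \<delta> s \<in> carrier F" and "s \<in> carrier S" "a \<in> hom_part A s" for \<delta> s a
    unfolding scale_def
    by (rule graded_extension_homogeneous[OF module_axioms
          linear_maps_scale[OF module_axioms that(1)] that(2,3)])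
  have inverse: "scale \<epsilon> (scale \<delta> a) = a"
    if \<delta>: "\<And>s. s \<in> carrier S \<Longrightarrow> \<delta> s \<in> carrier F" and \<epsilon>: "\<And>s. s \<in> carrier S \<Longrightarrow> \<epsilon> s \<in> carrier F"
      and 1: "\<And>s. s \<in> carrier S \<Longrightarrow> \<epsilon> s \<otimes> \<delta> s = \<one>" and a: "a \<in> carrier A" for \<delta> \<epsilon> a
  proof (rule linear_maps_eq_on_homogeneous[OF module_axioms linear_maps_comp[OF lin[OF \<delta>] lin[OF \<epsilon>]]
        linear_maps_id _ a])
    fix s a assume s: "s \<in> carrier S" and a: "a \<in> hom_part A s"
    have a': "a \<in> carrier A" using hom_part_subset[OF s] a by blast
    have "\<delta> s \<odot>\<^bsub>A\<^esub> a \<in> hom_part A s" using submoduleE(4)[OF hom_part_submodule[OF s] \<delta>[OF s] a] .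
    then show "scale \<epsilon> (scale \<delta> a) = a"
      using hom[OF \<delta> s a] hom[OF \<epsilon> s] smult_assoc1[OF \<epsilon>[OF s] \<delta>[OF s] a'] 1[OF s] a' by simp
  qed
  have \<gamma>': "\<gamma> s \<in> carrier F" "inv (\<gamma> s) \<in> carrier F" "\<gamma> s \<otimes> inv (\<gamma> s) = \<one>" "inv (\<gamma> s) \<otimes> \<gamma> s = \<one>"
    if "s \<in> carrier S" for s
    using \<gamma>[OF that] by (simp_all add: R.Units_closed)
  note lin1 = lin[of \<gamma>, OF \<gamma>'(1)] and lin2 = lin[of "\<lambda>s. inv (\<gamma> s)", OF \<gamma>'(2)]
  note hom1 = hom[of \<gamma>, OF \<gamma>'(1)] and hom2 = hom[of "\<lambda>s. inv (\<gamma> s)", OF \<gamma>'(2)]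
  note inv1 = inverse[of \<gamma> "\<lambda>s. inv (\<gamma> s)", OF \<gamma>'(1) \<gamma>'(2) \<gamma>'(4)]
    and inv2 = inverse[of "\<lambda>s. inv (\<gamma> s)" \<gamma>, OF \<gamma>'(2) \<gamma>'(1) \<gamma>'(3)]
  have "bij_betw (scale \<gamma>) (carrier A) (carrier A)"
    by (rule bij_betw_byWitness[where f' = "scale (\<lambda>s. inv (\<gamma> s))"])
      (use inv1 inv2 linear_maps_closed[OF lin1] linear_maps_closed[OF lin2] in auto)
  moreover have "scale \<gamma> ` hom_part A s = hom_part A s" if s: "s \<in> carrier S" for s
  proof
    show "scale \<gamma> ` hom_part A s \<subseteq> hom_part A s"
      using hom1[OF _ s] submoduleE(4)[OF hom_part_submodule[OF s] \<gamma>'(1)[OF s]] by auto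
    show "hom_part A s \<subseteq> scale \<gamma> ` hom_part A s"
    proof
      fix a assume a: "a \<in> hom_part A s"
      have "scale (\<lambda>s. inv (\<gamma> s)) a \<in> hom_part A s"
        using hom2[OF _ s a] submoduleE(4)[OF hom_part_submodule[OF s] \<gamma>'(2)[OF s] a] by auto
      then show "a \<in> scale \<gamma> ` hom_part A s"
        using inv2[of a] hom_part_subset[OF s] a by (metis image_eqI subsetD)
    qed
  qed
  ultimately show thesis using that lin1 hom1 by blast
qed

subsection \<open>Twists\<close>

lemma twist_simps:
  "carrier (twist S A \<mu>) = carrier A"
  "add (twist S A \<mu>) = add A"
  "zero (twist S A \<mu>) = zero A"
  "one (twist S A \<mu>) = one A"
  "smult (twist S A \<mu>) = smult A"
  "hom_part (twist S A \<mu>) = hom_part A"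
  by (simp_all add: twist_def)

text \<open>A twist alters only \<open>mult\<close>, which neither the decomposition nor the
  submodule property reads.\<close>

lemma twist_graded_module:
  assumes "graded_module F S A"
  shows "graded_module F S (twist S A \<mu>)"
proof -
  interpret graded_module F S A by fact
  have "is_hom_decomp S (twist S A \<mu>) = is_hom_decomp S A"
    unfolding is_hom_decomp_def fun_eq_iff
      finsum_change[where M = "twist S A \<mu>" and N = A, OF twist_simps(1-3)]
    by (simp add: twist_simps)
  then show ?thesis
    by (intro graded_module.intro graded_module_axioms.intro module_change[OF module_axioms])
      (simp_all add: twist_simps direct_sum submodule_change[of "twist S A \<mu>" A] hom_part_submodule)
qed

lemma graded_algebra_mult_bilinear:
  assumes "graded_algebra F S A"
  shows "mult A \<in> bilinear_maps F A A A"
proof -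
  interpret graded_algebra F S A by fact
  show ?thesis
    by (intro bilinear_mapsI linear_mapsI)
      (simp_all add: r_distr l_distr smult_mult_left smult_mult_right)
qed

text \<open>The assumption on A is bilinearity of its product, because the lemma is applied to the
  tensor algebra as well as to B and C.\<close>

lemma twist_mult:
  assumes "graded_module F S A" and "mult A \<in> bilinear_maps F A A A"
    and \<mu>: "\<And>x y. \<lbrakk>x \<in> carrier S; y \<in> carrier S\<rbrakk> \<Longrightarrow> \<mu> (x, y) \<in> carrier F"
  shows twist_mult_bilinear: "mult (twist S A \<mu>) \<in> bilinear_maps F A A A"
    and twist_mult_homogeneous: "\<lbrakk>x \<in> carrier S; y \<in> carrier S; a \<in> hom_part A x; b \<in> hom_part A y\<rbrakk> \<Longrightarrow>
      a \<otimes>\<^bsub>twist S A \<mu>\<^esub> b = \<mu> (x, y) \<odot>\<^bsub>A\<^esub> (a \<otimes>\<^bsub>A\<^esub> b)"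
proof -
  interpret graded_module F S A by fact
  have g: "(\<lambda>a b. \<mu> (x, y) \<odot>\<^bsub>A\<^esub> (a \<otimes>\<^bsub>A\<^esub> b)) \<in> bilinear_maps F A A A"
    if "x \<in> carrier S" "y \<in> carrier S" for x y
    by (rule bilinear_maps_scale[OF module_axioms assms(2) \<mu>[OF that]])
  note ext = graded_bilinear_extension[where g = "\<lambda>x y a b. \<mu> (x, y) \<odot>\<^bsub>A\<^esub> (a \<otimes>\<^bsub>A\<^esub> b)",
      OF assms(1) assms(1) module_axioms g]
  have eq: "mult (twist S A \<mu>) = (\<lambda>a b. \<Oplus>\<^bsub>A\<^esub> x \<in> hom_supp S A a. \<Oplus>\<^bsub>A\<^esub> y \<in> hom_supp S A b.
      \<mu> (x, y) \<odot>\<^bsub>A\<^esub> (hom_comp S A a x \<otimes>\<^bsub>A\<^esub> hom_comp S A b y))"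
    by (simp add: twist_def)
  show "mult (twist S A \<mu>) \<in> bilinear_maps F A A A"
    unfolding eq by (rule ext(1))
  show "a \<otimes>\<^bsub>twist S A \<mu>\<^esub> b = \<mu> (x, y) \<odot>\<^bsub>A\<^esub> (a \<otimes>\<^bsub>A\<^esub> b)"
    if "x \<in> carrier S" "y \<in> carrier S" "a \<in> hom_part A x" "b \<in> hom_part A y"
    unfolding eq by (rule ext(2)[OF _ _ that])
qed

subsection \<open>Free modules and quotient modules\<close>

lemma free_module_simps:
  "f \<in> carrier (free_module F I) \<longleftrightarrow>
    (\<forall>i\<in>I. f i \<in> carrier F) \<and> (\<forall>i. i \<notin> I \<longrightarrow> f i = \<zero>\<^bsub>F\<^esub>) \<and> finite {i. f i \<noteq> \<zero>\<^bsub>F\<^esub>}"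
  "zero (free_module F I) = (\<lambda>_. \<zero>\<^bsub>F\<^esub>)"
  "f \<oplus>\<^bsub>free_module F I\<^esub> g = (\<lambda>i. f i \<oplus>\<^bsub>F\<^esub> g i)"
  "r \<odot>\<^bsub>free_module F I\<^esub> f = (\<lambda>i. r \<otimes>\<^bsub>F\<^esub> f i)"
  by (simp_all add: free_module_def)

context cring
begin

lemma free_module_apply_closed: "f \<in> carrier (free_module R I) \<Longrightarrow> f i \<in> carrier R"
  by (cases "i \<in> I") (simp_all add: free_module_simps)

lemma free_module_module: "module R (free_module R I)"
proof (rule moduleI)
  note [simp] = free_module_apply_closed
  have add: "f \<oplus>\<^bsub>free_module R I\<^esub> g \<in> carrier (free_module R I)"
    if "f \<in> carrier (free_module R I)" "g \<in> carrier (free_module R I)" for f g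
  proof -
    have "finite ({i. f i \<noteq> \<zero>} \<union> {i. g i \<noteq> \<zero>})" using that by (simp add: free_module_simps)
    then have "finite {i. f i \<oplus> g i \<noteq> \<zero>}" by (rule rev_finite_subset) auto
    then show ?thesis using that by (simp add: free_module_simps)
  qed
  have smult: "r \<odot>\<^bsub>free_module R I\<^esub> f \<in> carrier (free_module R I)"
    if "r \<in> carrier R" "f \<in> carrier (free_module R I)" for r f
  proof -
    have "finite {i. f i \<noteq> \<zero>}" using that by (simp add: free_module_simps)
    then have "finite {i. r \<otimes> f i \<noteq> \<zero>}" by (rule rev_finite_subset) (use that in auto)
    then show ?thesis using that by (simp add: free_module_simps)
  qed
  show "abelian_group (free_module R I)"
  proof (rule abelian_groupI)
    fix f assume f: "f \<in> carrier (free_module R I)"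
    \<comment> \<open>The inverse of f is produced as its multiple by -1, whose finite support is
      already covered by \<open>smult\<close>.\<close>
    have "(\<ominus> \<one>) \<otimes> f i \<oplus> f i = \<zero>" for i
      using f by (simp add: l_minus l_neg)
    then have "(\<ominus> \<one>) \<odot>\<^bsub>free_module R I\<^esub> f \<oplus>\<^bsub>free_module R I\<^esub> f = \<zero>\<^bsub>free_module R I\<^esub>"
      by (simp add: free_module_simps)
    then show "\<exists>g\<in>carrier (free_module R I). g \<oplus>\<^bsub>free_module R I\<^esub> f = \<zero>\<^bsub>free_module R I\<^esub>"
      using smult[OF _ f, of "\<ominus> \<one>"] by auto
  qed (use add in \<open>auto simp: free_module_simps(2-4) free_module_simps(1)[of "\<lambda>_. \<zero>"] a_assoc a_comm a_lcomm\<close>)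
  show "cring R" by (rule is_cring)
  show "r \<odot>\<^bsub>free_module R I\<^esub> f \<in> carrier (free_module R I)"
    if "r \<in> carrier R" "f \<in> carrier (free_module R I)" for r f
    using smult that .
qed (simp_all add: free_module_simps(2-4) free_module_apply_closed l_distr r_distr m_assoc)

lemma free_gen_closed: "i \<in> I \<Longrightarrow> free_gen R i \<in> carrier (free_module R I)"
  by (auto simp: free_module_simps free_gen_def)

lemma free_module_finsum_apply:
  assumes "\<And>p. p \<in> A \<Longrightarrow> h p \<in> carrier (free_module R I)"
  shows "(\<Oplus>\<^bsub>free_module R I\<^esub>p\<in>A. h p) i = (\<Oplus>p\<in>A. h p i)"
proof -
  interpret free: module R "free_module R I" by (rule free_module_module)
  show ?thesis
  proof (cases "finite A")
    case True
    then show ?thesis using assms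
      by (induction A) (simp_all add: free_module_simps(2,3) Pi_iff free_module_apply_closed[of _ I])
  qed (simp add: free_module_simps(2))
qed

lemma free_module_expansion:
  assumes "f \<in> carrier (free_module R I)"
  shows "f = (\<Oplus>\<^bsub>free_module R I\<^esub>p\<in>{p. f p \<noteq> \<zero>}. f p \<odot>\<^bsub>free_module R I\<^esub> free_gen R p)"
proof
  fix i
  interpret free: module R "free_module R I" by (rule free_module_module)
  let ?A = "{p. f p \<noteq> \<zero>}"
  note cl = free_module_apply_closed[OF assms]
  have A: "?A \<subseteq> I" "finite ?A" using assms by (auto simp: free_module_simps)
  have "(\<Oplus>\<^bsub>free_module R I\<^esub>p\<in>?A. f p \<odot>\<^bsub>free_module R I\<^esub> free_gen R p) i
      = (\<Oplus>p\<in>?A. (f p \<odot>\<^bsub>free_module R I\<^esub> free_gen R p) i)"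
    using A(1) cl by (intro free_module_finsum_apply) (auto intro!: free_gen_closed)
  also have "\<dots> = (\<Oplus>p\<in>?A. if i = p then f p else \<zero>)"
    using cl by (intro finsum_cong') (auto simp: free_module_simps free_gen_def)
  also have "\<dots> = f i"
  proof (cases "i \<in> ?A")
    case True
    then show ?thesis using add.finprod_singleton[OF True A(2)] cl by simp
  next
    case False
    then have "(\<Oplus>p\<in>?A. if i = p then f p else \<zero>) = (\<Oplus>p\<in>?A. \<zero>)"
      by (intro finsum_cong') auto
    then show ?thesis using False by simp
  qed
  finally show "f i = (\<Oplus>\<^bsub>free_module R I\<^esub>p\<in>?A. f p \<odot>\<^bsub>free_module R I\<^esub> free_gen R p) i"
    by (rule sym)
qed

text \<open>The analogue of \<open>sum_over_hom_supp\<close>: the support of f may be enlarged to a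
  set shared by several functions.\<close>

lemma free_extension_eq:
  assumes "module R N" and "m \<in> I \<rightarrow> carrier N"
    and "f \<in> carrier (free_module R I)" and "{p. f p \<noteq> \<zero>} \<subseteq> A" and "A \<subseteq> I" and "finite A"
  shows "(\<Oplus>\<^bsub>N\<^esub>p\<in>{p. f p \<noteq> \<zero>}. f p \<odot>\<^bsub>N\<^esub> m p) = (\<Oplus>\<^bsub>N\<^esub>p\<in>A. f p \<odot>\<^bsub>N\<^esub> m p)"
proof -
  interpret N: module R N by fact
  show ?thesis using assms(2-) free_module_apply_closed[OF assms(3)]
    by (intro N.add.finprod_mono_neutral_cong_left) (auto simp: Pi_iff)
qed

text \<open>The linear extension of m from the free generators. It is written as a sum over the
  support of f because \<open>tensor_mult\<close> has that form.\<close>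

lemma free_extension_linear:
  assumes "module R N" and "m \<in> I \<rightarrow> carrier N"
  shows "(\<lambda>f. \<Oplus>\<^bsub>N\<^esub>p\<in>{p. f p \<noteq> \<zero>}. f p \<odot>\<^bsub>N\<^esub> m p) \<in> linear_maps R (free_module R I) N"
    (is "?h \<in> _")
proof -
  interpret N: module R N by fact
  interpret free: module R "free_module R I" by (rule free_module_module)
  let ?M = "free_module R I"
  note eq = free_extension_eq[OF assms]
  have supp: "{p. f p \<noteq> \<zero>} \<subseteq> I" "finite {p. f p \<noteq> \<zero>}" if "f \<in> carrier ?M" for f
    using that by (auto simp: free_module_simps)
  have cl: "(\<lambda>p. f p \<odot>\<^bsub>N\<^esub> m p) \<in> A \<rightarrow> carrier N" if "f \<in> carrier ?M" "A \<subseteq> I" for f A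
    using that assms(2) free_module_apply_closed[OF that(1)] by (auto simp: Pi_iff)
  show ?thesis
  proof (rule linear_mapsI)
    fix f assume f: "f \<in> carrier ?M"
    show "?h f \<in> carrier N" using cl[OF f supp(1)[OF f]] by simp
  next
    fix f g assume f: "f \<in> carrier ?M" and g: "g \<in> carrier ?M"
    let ?fg = "f \<oplus>\<^bsub>?M\<^esub> g"
    \<comment> \<open>The third set lies in the union of the other two; listing it makes every
      inclusion required by \<open>eq\<close> immediate.\<close>
    let ?A = "{p. f p \<noteq> \<zero>} \<union> {p. g p \<noteq> \<zero>} \<union> {p. ?fg p \<noteq> \<zero>}"
    have fg: "?fg \<in> carrier ?M" using f g by simp
    have A: "?A \<subseteq> I" "finite ?A" using supp[OF f] supp[OF g] supp[OF fg] by auto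
    have "?h ?fg = (\<Oplus>\<^bsub>N\<^esub>p\<in>?A. ?fg p \<odot>\<^bsub>N\<^esub> m p)" by (rule eq[OF fg _ A]) auto
    also have "\<dots> = (\<Oplus>\<^bsub>N\<^esub>p\<in>?A. f p \<odot>\<^bsub>N\<^esub> m p \<oplus>\<^bsub>N\<^esub> g p \<odot>\<^bsub>N\<^esub> m p)"
    proof (rule N.finsum_cong')
      fix p assume "p \<in> ?A"
      then have "m p \<in> carrier N" using A(1) assms(2) by blast
      then show "?fg p \<odot>\<^bsub>N\<^esub> m p = f p \<odot>\<^bsub>N\<^esub> m p \<oplus>\<^bsub>N\<^esub> g p \<odot>\<^bsub>N\<^esub> m p"
        using free_module_apply_closed[OF f] free_module_apply_closed[OF g]
        by (simp add: free_module_simps(3) N.smult_l_distr)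
    qed (use cl[OF f A(1)] cl[OF g A(1)] in \<open>auto simp: Pi_iff\<close>)
    also have "\<dots> = (\<Oplus>\<^bsub>N\<^esub>p\<in>?A. f p \<odot>\<^bsub>N\<^esub> m p) \<oplus>\<^bsub>N\<^esub> (\<Oplus>\<^bsub>N\<^esub>p\<in>?A. g p \<odot>\<^bsub>N\<^esub> m p)"
      by (rule N.finsum_addf[OF cl[OF f A(1)] cl[OF g A(1)]])
    also have "(\<Oplus>\<^bsub>N\<^esub>p\<in>?A. f p \<odot>\<^bsub>N\<^esub> m p) = ?h f" by (rule eq[OF f _ A, symmetric]) auto
    also have "(\<Oplus>\<^bsub>N\<^esub>p\<in>?A. g p \<odot>\<^bsub>N\<^esub> m p) = ?h g" by (rule eq[OF g _ A, symmetric]) auto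
    finally show "?h ?fg = ?h f \<oplus>\<^bsub>N\<^esub> ?h g" .
  next
    fix r f assume r: "r \<in> carrier R" and f: "f \<in> carrier ?M"
    let ?rf = "r \<odot>\<^bsub>?M\<^esub> f"
    let ?A = "{p. f p \<noteq> \<zero>}"
    have rf: "?rf \<in> carrier ?M" using r f by simp
    note A = supp[OF f]
    have "?h ?rf = (\<Oplus>\<^bsub>N\<^esub>p\<in>?A. ?rf p \<odot>\<^bsub>N\<^esub> m p)"
      by (rule eq[OF rf _ A]) (use r in \<open>auto simp: free_module_simps(4)\<close>)
    also have "\<dots> = (\<Oplus>\<^bsub>N\<^esub>p\<in>?A. r \<odot>\<^bsub>N\<^esub> (f p \<odot>\<^bsub>N\<^esub> m p))"
    proof (rule N.finsum_cong')
      fix p assume "p \<in> ?A"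
      then have "m p \<in> carrier N" using A(1) assms(2) by blast
      then show "?rf p \<odot>\<^bsub>N\<^esub> m p = r \<odot>\<^bsub>N\<^esub> (f p \<odot>\<^bsub>N\<^esub> m p)"
        using r free_module_apply_closed[OF f] by (simp add: free_module_simps(4) N.smult_assoc1)
    qed (use r cl[OF f A(1)] in \<open>auto simp: Pi_iff\<close>)
    also have "\<dots> = r \<odot>\<^bsub>N\<^esub> ?h f"
      by (rule N.finsum_smult_ldistr[OF A(2) r cl[OF f A(1)], symmetric])
    finally show "?h ?rf = r \<odot>\<^bsub>N\<^esub> ?h f" .
  qed
qed

lemma free_extension_gen:
  assumes "module R N" and "m \<in> I \<rightarrow> carrier N" and "i \<in> I"
  shows "(\<Oplus>\<^bsub>N\<^esub>p\<in>{p. free_gen R i p \<noteq> \<zero>}. free_gen R i p \<odot>\<^bsub>N\<^esub> m p) = m i"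
proof -
  interpret N: module R N by fact
  have "m i \<in> carrier N" using assms(2,3) by blast
  moreover have "(\<Oplus>\<^bsub>N\<^esub>p\<in>{p. free_gen R i p \<noteq> \<zero>}. free_gen R i p \<odot>\<^bsub>N\<^esub> m p)
      = (\<Oplus>\<^bsub>N\<^esub>p\<in>{i}. free_gen R i p \<odot>\<^bsub>N\<^esub> m p)"
    using assms(3)
    by (intro free_extension_eq[OF assms(1,2) free_gen_closed[OF assms(3)]])
      (auto simp: free_gen_def)
  ultimately show ?thesis by (simp add: free_gen_def)
qed

end

section \<open>Quotient modules and maps out of them\<close>

lemma quotient_module_simps:
  "carrier (quotient_module F M N) = a_rcosets\<^bsub>M\<^esub> N"
  "zero (quotient_module F M N) = N"
  "add (quotient_module F M N) = set_add M"
  "X \<in> a_rcosets\<^bsub>M\<^esub> N \<Longrightarrow> r \<odot>\<^bsub>quotient_module F M N\<^esub> X = (\<Union>x\<in>X. N +>\<^bsub>M\<^esub> (r \<odot>\<^bsub>M\<^esub> x))"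
  by (simp_all add: quotient_module_def)

context module
begin

lemma submodule_imp_abelian_subgroup:
  assumes "submodule N R M"
  shows "abelian_subgroup N M"
  using assms by (intro abelian_subgroupI3 additive_subgroup.intro M.abelian_group_axioms)
    (simp add: submodule_def)

lemma quotient_module_carrierE:
  assumes "X \<in> carrier (quotient_module R M N)"
  obtains x where "x \<in> carrier M" and "X = N +>\<^bsub>M\<^esub> x"
  using assms by (auto simp: quotient_module_simps A_RCOSETS_def')

lemma quotient_module_eq_iff:
  assumes "submodule N R M" and "x \<in> carrier M" and "y \<in> carrier M"
  shows "N +>\<^bsub>M\<^esub> x = N +>\<^bsub>M\<^esub> y \<longleftrightarrow> x \<ominus>\<^bsub>M\<^esub> y \<in> N"
proof -
  interpret N: abelian_subgroup N M by (rule submodule_imp_abelian_subgroup[OF assms(1)])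
  have "N +>\<^bsub>M\<^esub> x = N +>\<^bsub>M\<^esub> y \<longleftrightarrow> x \<in> N +>\<^bsub>M\<^esub> y"
    using assms N.a_repr_independence' N.a_rcos_self by metis
  then show ?thesis using assms N.a_rcos_module by (simp add: a_minus_def)
qed

text \<open>Changing x by an element of N changes its multiple by an element of N, so the union over
  representatives in the definition is a union of equal cosets.\<close>

lemma quotient_module_smult:
  assumes "submodule N R M" and "r \<in> carrier R" and "x \<in> carrier M"
  shows "r \<odot>\<^bsub>quotient_module R M N\<^esub> (N +>\<^bsub>M\<^esub> x) = N +>\<^bsub>M\<^esub> (r \<odot>\<^bsub>M\<^esub> x)"
proof -
  interpret N: abelian_subgroup N M by (rule submodule_imp_abelian_subgroup[OF assms(1)])
  have *: "N +>\<^bsub>M\<^esub> (r \<odot>\<^bsub>M\<^esub> y) = N +>\<^bsub>M\<^esub> (r \<odot>\<^bsub>M\<^esub> x)" if "y \<in> N +>\<^bsub>M\<^esub> x" for y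
  proof -
    have y: "y \<in> carrier M" using N.a_elemrcos_carrier[OF assms(3) that] .
    have "y \<ominus>\<^bsub>M\<^esub> x \<in> N" using N.a_rcos_module[OF assms(3) y] that by (simp add: a_minus_def)
    then have "r \<odot>\<^bsub>M\<^esub> (y \<ominus>\<^bsub>M\<^esub> x) \<in> N" using submoduleE(4)[OF assms(1,2)] by blast
    also have "r \<odot>\<^bsub>M\<^esub> (y \<ominus>\<^bsub>M\<^esub> x) = r \<odot>\<^bsub>M\<^esub> y \<ominus>\<^bsub>M\<^esub> r \<odot>\<^bsub>M\<^esub> x"
      using assms y by (simp add: a_minus_def smult_r_distr smult_r_minus)
    finally show ?thesis using quotient_module_eq_iff[OF assms(1)] assms y by simp
  qed
  have "x \<in> N +>\<^bsub>M\<^esub> x" using N.a_rcos_self assms(3) by blast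
  then show ?thesis using * assms(3) M.a_rcosetsI[OF N.a_subset assms(3)]
    by (subst quotient_module_simps(4)) blast+
qed

lemma quotient_module_add:
  assumes "submodule N R M" and "x \<in> carrier M" and "y \<in> carrier M"
  shows "(N +>\<^bsub>M\<^esub> x) \<oplus>\<^bsub>quotient_module R M N\<^esub> (N +>\<^bsub>M\<^esub> y) = N +>\<^bsub>M\<^esub> (x \<oplus>\<^bsub>M\<^esub> y)"
proof -
  interpret N: abelian_subgroup N M by (rule submodule_imp_abelian_subgroup[OF assms(1)])
  show ?thesis using N.a_rcos_sum[OF assms(2,3)] by (simp add: quotient_module_simps)
qed

lemma quotient_module_closed:
  assumes "submodule N R M" and "x \<in> carrier M"
  shows "N +>\<^bsub>M\<^esub> x \<in> carrier (quotient_module R M N)"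
  using M.a_rcosetsI[OF submoduleE(1)[OF assms(1)] assms(2)] by (simp add: quotient_module_simps)

lemma quotient_module_zero:
  assumes "submodule N R M"
  shows "\<zero>\<^bsub>quotient_module R M N\<^esub> = N +>\<^bsub>M\<^esub> \<zero>\<^bsub>M\<^esub>"
  using M.a_coset_add_zero[OF submoduleE(1)[OF assms]] by (simp add: quotient_module_simps)

lemma quotient_module_module:
  assumes N: "submodule N R M"
  shows "module R (quotient_module R M N)"
proof (rule moduleI)
  let ?Q = "quotient_module R M N"
  note [simp] = quotient_module_add[OF N] quotient_module_smult[OF N] quotient_module_closed[OF N]
    quotient_module_zero[OF N]
  show "cring R" by (rule is_cring)
  show "abelian_group ?Q"
  proof (rule abelian_groupI)
    fix X assume "X \<in> carrier ?Q"
    then obtain x where x: "x \<in> carrier M" "X = N +>\<^bsub>M\<^esub> x" by (rule quotient_module_carrierE)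
    then show "\<exists>Y\<in>carrier ?Q. Y \<oplus>\<^bsub>?Q\<^esub> X = \<zero>\<^bsub>?Q\<^esub>"
      by (intro bexI[of _ "N +>\<^bsub>M\<^esub> (\<ominus>\<^bsub>M\<^esub> x)"]) (simp_all add: M.l_neg)
  qed (auto elim!: quotient_module_carrierE simp: M.a_assoc M.a_comm M.a_lcomm)
qed (auto elim!: quotient_module_carrierE
    simp: quotient_module_add[OF N] quotient_module_smult[OF N] quotient_module_closed[OF N]
      smult_l_distr smult_r_distr smult_assoc1)

lemma quotient_map_linear:
  assumes "submodule N R M"
  shows "(\<lambda>x. N +>\<^bsub>M\<^esub> x) \<in> linear_maps R M (quotient_module R M N)"
  using assms
  by (intro linear_mapsI)
    (simp_all add: quotient_module_add quotient_module_smult quotient_module_closed)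

text \<open>The lift evaluates h at a representative picked by \<open>SOME\<close>. Two
  representatives differ by an element of N, on which h vanishes, so the choice is
  immaterial.\<close>

lemma quotient_module_lift:
  assumes N: "submodule N R M" and "module R Q"
    and h: "h \<in> linear_maps R M Q" and ker: "\<And>x. x \<in> N \<Longrightarrow> h x = \<zero>\<^bsub>Q\<^esub>"
  obtains k where "k \<in> linear_maps R (quotient_module R M N) Q"
    and "\<And>x. x \<in> carrier M \<Longrightarrow> k (N +>\<^bsub>M\<^esub> x) = h x"
proof
  interpret Q: module R Q by fact
  define k where "k = (\<lambda>X. h (SOME x. x \<in> carrier M \<and> X = N +>\<^bsub>M\<^esub> x))"
  show k: "k (N +>\<^bsub>M\<^esub> x) = h x" if x: "x \<in> carrier M" for x
  proof -
    define y where "y = (SOME y. y \<in> carrier M \<and> N +>\<^bsub>M\<^esub> x = N +>\<^bsub>M\<^esub> y)"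
    have y: "y \<in> carrier M" "N +>\<^bsub>M\<^esub> x = N +>\<^bsub>M\<^esub> y"
      using someI[of "\<lambda>y. y \<in> carrier M \<and> N +>\<^bsub>M\<^esub> x = N +>\<^bsub>M\<^esub> y" x] x by (auto simp: y_def)
    then have "h (x \<ominus>\<^bsub>M\<^esub> y) = \<zero>\<^bsub>Q\<^esub>"
      using ker quotient_module_eq_iff[OF N x y(1)] by blast
    then have "h x \<ominus>\<^bsub>Q\<^esub> h y = \<zero>\<^bsub>Q\<^esub>"
      using linear_maps_add[OF h x M.a_inv_closed[OF y(1)]]
        linear_maps_a_inv[OF module_axioms assms(2) h y(1)] by (simp add: a_minus_def)
    then have "h x = h y"
      using linear_maps_closed[OF h] x y(1) by (metis Q.add.inv_closed Q.add.inv_comm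
          Q.add.inv_equality Q.add.inv_inv a_minus_def)
    then show ?thesis by (simp add: k_def y_def)
  qed
  show "k \<in> linear_maps R (quotient_module R M N) Q"
    using linear_mapsD[OF h]
    by (intro linear_mapsI)
      (auto elim!: quotient_module_carrierE simp: quotient_module_add[OF N]
        quotient_module_smult[OF N] k)
qed

end

subsection \<open>Tensor products\<close>

locale tensor_product = B: module F B + C: module F C
  for F :: "('f, 'x) ring_scheme" (structure)
    and B :: "('f, 'b, 'y) module_scheme" and C :: "('f, 'c, 'z) module_scheme"
begin

abbreviation "free \<equiv> free_module F (carrier B \<times> carrier C)"
abbreviation "kern \<equiv> tensor_kernel F B C"
abbreviation "K \<equiv> tensor_module F B C"
abbreviation "pure \<equiv> pure_tensor F B C"

sublocale free: module F free
  by (rule B.free_module_module)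

lemma free_gen_pair_closed:
  "\<lbrakk>b \<in> carrier B; c \<in> carrier C\<rbrakk> \<Longrightarrow> free_gen F (b, c) \<in> carrier free"
  by (simp add: B.free_gen_closed)

lemma tensor_rels_subset: "tensor_rels F B C \<subseteq> carrier free"
  by (auto simp: tensor_rels_def Let_def a_minus_def free_gen_pair_closed)

lemma tensor_kernel_submodule: "submodule kern F free"
  unfolding tensor_kernel_def by (rule free.module_span_submodule[OF tensor_rels_subset])

sublocale K: module F K
  unfolding tensor_module_def by (rule free.quotient_module_module[OF tensor_kernel_submodule])

lemma tensor_rel_cosets_eq:
  assumes "f \<ominus>\<^bsub>free\<^esub> g \<in> tensor_rels F B C" and "f \<in> carrier free" and "g \<in> carrier free"
  shows "kern +>\<^bsub>free\<^esub> f = kern +>\<^bsub>free\<^esub> g"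
proof -
  have "f \<ominus>\<^bsub>free\<^esub> g \<in> kern"
    unfolding tensor_kernel_def by (rule subsetD[OF module_span_superset assms(1)])
  then show ?thesis
    using free.quotient_module_eq_iff[OF tensor_kernel_submodule assms(2,3)] by simp
qed

lemma quotient_map_linear: "(\<lambda>f. kern +>\<^bsub>free\<^esub> f) \<in> linear_maps F free K"
  unfolding tensor_module_def by (rule free.quotient_map_linear[OF tensor_kernel_submodule])

text \<open>The four families in \<open>tensor_rels\<close> are exactly the two additivity and the
  two homogeneity clauses of bilinearity.\<close>

lemma pure_tensor_bilinear: "pure \<in> bilinear_maps F B C K"
proof (rule bilinear_mapsI; rule linear_mapsI)
  note q = linear_mapsD[OF quotient_map_linear]
  note [simp] = free_gen_pair_closed
  show closed: "pure b c \<in> carrier K" "pure b c \<in> carrier K"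
    if "b \<in> carrier B" "c \<in> carrier C" for b c
    using that by (simp_all add: pure_tensor_def q)
  fix b b' c assume b: "b \<in> carrier B" "b' \<in> carrier B" and c: "c \<in> carrier C"
  have "free_gen F (b \<oplus>\<^bsub>B\<^esub> b', c) \<ominus>\<^bsub>free\<^esub> (free_gen F (b, c) \<oplus>\<^bsub>free\<^esub> free_gen F (b', c))
      \<in> tensor_rels F B C"
    using b c unfolding tensor_rels_def Let_def by blast
  then show "pure (b \<oplus>\<^bsub>B\<^esub> b') c = pure b c \<oplus>\<^bsub>K\<^esub> pure b' c"
    using b c by (simp add: pure_tensor_def q(2)[symmetric] tensor_rel_cosets_eq)
next
  note q = linear_mapsD[OF quotient_map_linear]
  note [simp] = free_gen_pair_closed
  fix b c c' assume b: "b \<in> carrier B" and c: "c \<in> carrier C" "c' \<in> carrier C"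
  have "free_gen F (b, c \<oplus>\<^bsub>C\<^esub> c') \<ominus>\<^bsub>free\<^esub> (free_gen F (b, c) \<oplus>\<^bsub>free\<^esub> free_gen F (b, c'))
      \<in> tensor_rels F B C"
    using b c unfolding tensor_rels_def Let_def by blast
  then show "pure b (c \<oplus>\<^bsub>C\<^esub> c') = pure b c \<oplus>\<^bsub>K\<^esub> pure b c'"
    using b c by (simp add: pure_tensor_def q(2)[symmetric] tensor_rel_cosets_eq)
next
  note q = linear_mapsD[OF quotient_map_linear]
  note [simp] = free_gen_pair_closed
  fix r b c assume r: "r \<in> carrier F" and b: "b \<in> carrier B" and c: "c \<in> carrier C"
  have "free_gen F (r \<odot>\<^bsub>B\<^esub> b, c) \<ominus>\<^bsub>free\<^esub> r \<odot>\<^bsub>free\<^esub> free_gen F (b, c) \<in> tensor_rels F B C"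
    and "free_gen F (b, r \<odot>\<^bsub>C\<^esub> c) \<ominus>\<^bsub>free\<^esub> r \<odot>\<^bsub>free\<^esub> free_gen F (b, c) \<in> tensor_rels F B C"
    using r b c unfolding tensor_rels_def Let_def by blast+
  then show "pure (r \<odot>\<^bsub>B\<^esub> b) c = r \<odot>\<^bsub>K\<^esub> pure b c" "pure b (r \<odot>\<^bsub>C\<^esub> c) = r \<odot>\<^bsub>K\<^esub> pure b c"
    using r b c by (simp_all add: pure_tensor_def q(3)[symmetric] tensor_rel_cosets_eq)
qed

lemma tensor_module_carrierE:
  assumes "X \<in> carrier K"
  obtains f where "f \<in> carrier free" and "X = kern +>\<^bsub>free\<^esub> f" and "f \<in> X"
proof -
  interpret N: abelian_subgroup kern free
    by (rule free.submodule_imp_abelian_subgroup[OF tensor_kernel_submodule])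
  obtain f where "f \<in> carrier free" "X = kern +>\<^bsub>free\<^esub> f"
    using assms unfolding tensor_module_def by (rule free.quotient_module_carrierE)
  then show thesis using that N.a_rcos_self by blast
qed

lemma tensor_module_memberD:
  assumes "X \<in> carrier K" and "f \<in> X"
  shows "f \<in> carrier free" and "X = kern +>\<^bsub>free\<^esub> f"
proof -
  interpret N: abelian_subgroup kern free
    by (rule free.submodule_imp_abelian_subgroup[OF tensor_kernel_submodule])
  obtain g where g: "g \<in> carrier free" "X = kern +>\<^bsub>free\<^esub> g"
    using assms(1) by (rule tensor_module_carrierE)
  then show "f \<in> carrier free" "X = kern +>\<^bsub>free\<^esub> f"
    using N.a_elemrcos_carrier N.a_repr_independence' assms(2) by blast+
qed

text \<open>Besides the usual factorization through pure tensors, the second conclusion evaluates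
  the defining sum at every representative f of X. This is what \<open>tensor_mult\<close> requires,
  as its union runs over all of them.\<close>

lemma tensor_universal:
  assumes "module F Q" and m: "m \<in> bilinear_maps F B C Q"
  obtains L where "L \<in> linear_maps F K Q"
    and "\<And>X f. \<lbrakk>X \<in> carrier K; f \<in> X\<rbrakk> \<Longrightarrow>
      (\<Oplus>\<^bsub>Q\<^esub>p\<in>{p. f p \<noteq> \<zero>}. f p \<odot>\<^bsub>Q\<^esub> m (fst p) (snd p)) = L X"
    and "\<And>b c. \<lbrakk>b \<in> carrier B; c \<in> carrier C\<rbrakk> \<Longrightarrow> L (pure b c) = m b c"
proof -
  interpret Q: module F Q by fact
  define h where "h = (\<lambda>f. \<Oplus>\<^bsub>Q\<^esub>p\<in>{p. f p \<noteq> \<zero>}. f p \<odot>\<^bsub>Q\<^esub> m (fst p) (snd p))"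
  have mcl: "(\<lambda>p. m (fst p) (snd p)) \<in> carrier B \<times> carrier C \<rightarrow> carrier Q"
    using bilinear_maps_closed[OF m] by auto
  have h: "h \<in> linear_maps F free Q"
    unfolding h_def by (rule B.free_extension_linear[OF assms(1) mcl])
  have gen: "h (free_gen F (b, c)) = m b c" if "b \<in> carrier B" "c \<in> carrier C" for b c
    unfolding h_def using B.free_extension_gen[OF assms(1) mcl, of "(b, c)"] that by simp
  note [simp] = free_gen_pair_closed
  have diff: "h (f \<ominus>\<^bsub>free\<^esub> g) = \<zero>\<^bsub>Q\<^esub>"
    if "f \<in> carrier free" "g \<in> carrier free" "h f = h g" for f g
    using that linear_maps_a_inv[OF free.module_axioms assms(1) h that(2)]
      linear_maps_add[OF h that(1) free.a_inv_closed[OF that(2)]] linear_maps_closed[OF h that(2)]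
    by (simp add: a_minus_def Q.r_neg)
  \<comment> \<open>Bilinearity of m makes h vanish on each relation; the kernel is the least
    submodule containing the relations, so h vanishes there too.\<close>
  have "tensor_rels F B C \<subseteq> {f \<in> carrier free. h f = \<zero>\<^bsub>Q\<^esub>}"
    using tensor_rels_subset bilinear_mapsD[OF m]
    unfolding tensor_rels_def Let_def
    by (auto intro!: diff simp: gen linear_maps_add[OF h] linear_maps_smult[OF h]
        linear_maps_add[OF bilinear_maps_right[OF m]] linear_maps_add[OF bilinear_maps_left[OF m]]
        linear_maps_smult[OF bilinear_maps_right[OF m]] linear_maps_smult[OF bilinear_maps_left[OF m]])
  then have "kern \<subseteq> {f \<in> carrier free. h f = \<zero>\<^bsub>Q\<^esub>}"
    unfolding tensor_kernel_def
    by (intro module_span_minimal submodule_equalizer[OF free.module_axioms assms(1) h]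
        linear_maps_const_zero assms(1))
  then have ker: "h f = \<zero>\<^bsub>Q\<^esub>" if "f \<in> kern" for f using that by blast
  obtain L where L: "L \<in> linear_maps F K Q" "\<And>f. f \<in> carrier free \<Longrightarrow> L (kern +>\<^bsub>free\<^esub> f) = h f"
    unfolding tensor_module_def
    by (rule free.quotient_module_lift[OF tensor_kernel_submodule assms(1) h ker])
      (assumption, rule that[unfolded tensor_module_def])
  show thesis
  proof
    fix X f assume "X \<in> carrier K" "f \<in> X"
    then show "(\<Oplus>\<^bsub>Q\<^esub>p\<in>{p. f p \<noteq> \<zero>}. f p \<odot>\<^bsub>Q\<^esub> m (fst p) (snd p)) = L X"
      using tensor_module_memberD[of X f] L(2)[of f] by (simp add: h_def)
  qed (use L gen in \<open>simp_all add: pure_tensor_def\<close>)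
qed

text \<open>Expanding a representative in the free generators exhibits each tensor as a finite
  combination of pure ones.\<close>

lemma tensor_induct:
  assumes "submodule H F K" and "\<And>b c. \<lbrakk>b \<in> carrier B; c \<in> carrier C\<rbrakk> \<Longrightarrow> pure b c \<in> H"
  shows "carrier K \<subseteq> H"
proof
  fix X assume "X \<in> carrier K"
  then obtain f where f: "f \<in> carrier free" "X = kern +>\<^bsub>free\<^esub> f" by (rule tensor_module_carrierE)
  let ?A = "{p. f p \<noteq> \<zero>}"
  note q = quotient_map_linear
  have A: "?A \<subseteq> carrier B \<times> carrier C" using f(1) by (auto simp: free_module_simps)
  have gcl: "free_gen F p \<in> carrier free" if "p \<in> ?A" for p
    using that A by (auto intro: B.free_gen_closed)
  have fcl: "f p \<in> carrier F" for p by (rule B.free_module_apply_closed[OF f(1)])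
  have "X = kern +>\<^bsub>free\<^esub> (\<Oplus>\<^bsub>free\<^esub>p\<in>?A. f p \<odot>\<^bsub>free\<^esub> free_gen F p)"
    unfolding f(2) by (rule arg_cong[OF B.free_module_expansion[OF f(1)]])
  also have "\<dots> = (\<Oplus>\<^bsub>K\<^esub>p\<in>?A. kern +>\<^bsub>free\<^esub> (f p \<odot>\<^bsub>free\<^esub> free_gen F p))"
    using gcl fcl by (intro linear_maps_finsum[OF free.module_axioms K.module_axioms q]) auto
  also have "\<dots> \<in> H"
  proof (rule K.submodule_finsum_closed[OF assms(1)])
    fix p assume p: "p \<in> ?A"
    obtain b c where bc: "p = (b, c)" by (cases p)
    have "pure b c \<in> H" using p A bc assms(2) by auto
    then have "f p \<odot>\<^bsub>K\<^esub> pure b c \<in> H" using K.submoduleE(4)[OF assms(1) fcl] by blast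
    then show "kern +>\<^bsub>free\<^esub> (f p \<odot>\<^bsub>free\<^esub> free_gen F p) \<in> H"
      using linear_maps_smult[OF q fcl gcl[OF p]] bc by (simp add: pure_tensor_def)
  qed
  finally show "X \<in> H" .
qed

end

text \<open>The tensor constructions read the linear structure, the units and the homogeneous parts
  of the factors, all unchanged by a twist. Hence the two algebras to be compared literally share
  their underlying module.\<close>

lemma twist_tensor_module:
  "tensor_module F (twist S B \<nu>) (twist T C \<xi>) = tensor_module F B C"
  "pure_tensor F (twist S B \<nu>) (twist T C \<xi>) = pure_tensor F B C"
  "graded_tensor F (twist S B \<nu>) (twist T C \<xi>) P = graded_tensor F B C P"
proof -
  have rels: "tensor_rels F (twist S B \<nu>) (twist T C \<xi>) = tensor_rels F B C"
    by (simp add: tensor_rels_def twist_simps)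
  then show mod: "tensor_module F (twist S B \<nu>) (twist T C \<xi>) = tensor_module F B C"
    by (simp add: tensor_module_def tensor_kernel_def twist_simps)
  show pure: "pure_tensor F (twist S B \<nu>) (twist T C \<xi>) = pure_tensor F B C"
    by (simp add: fun_eq_iff pure_tensor_def tensor_kernel_def twist_simps rels)
  have "tensor_mult F (twist S B \<nu>) (twist T C \<xi>) P = tensor_mult F B C P"
    by (simp add: fun_eq_iff tensor_mult_def mod)
  then show "graded_tensor F (twist S B \<nu>) (twist T C \<xi>) P = graded_tensor F B C P"
    by (simp add: graded_tensor_def mod pure twist_simps)
qed

text \<open>The universal property is applied twice: for fixed p the rule P p extends to a linear
  map L p in the second factor, and for fixed Y the map sending p to L p Y extends to a linear map R
  Y in the first. The double sum for representatives f and g then equals R Y X whatever f and g are,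
  so the union in \<open>tensor_mult\<close> is that single coset.\<close>

lemma (in tensor_product) tensor_mult_extends:
  assumes l: "\<And>q. q \<in> carrier B \<times> carrier C \<Longrightarrow> (\<lambda>b c. P (b, c) q) \<in> bilinear_maps F B C K"
    and r: "\<And>p. p \<in> carrier B \<times> carrier C \<Longrightarrow> (\<lambda>b c. P p (b, c)) \<in> bilinear_maps F B C K"
  shows tensor_mult_bilinear: "tensor_mult F B C P \<in> bilinear_maps F K K K"
    and tensor_mult_pure: "\<lbrakk>b \<in> carrier B; c \<in> carrier C; b' \<in> carrier B; c' \<in> carrier C\<rbrakk> \<Longrightarrow>
      tensor_mult F B C P (pure b c) (pure b' c') = P (b, c) (b', c')"
proof -
  let ?BC = "carrier B \<times> carrier C"
  have Pcl: "P p q \<in> carrier K" if "p \<in> ?BC" "q \<in> ?BC" for p q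
    using bilinear_maps_closed[OF r[OF that(1)], of "fst q" "snd q"] that(2) by auto
  have "\<forall>p\<in>?BC. \<exists>L. L \<in> linear_maps F K K \<and>
      (\<forall>Y\<in>carrier K. \<forall>g\<in>Y. (\<Oplus>\<^bsub>K\<^esub>q\<in>{q. g q \<noteq> \<zero>}. g q \<odot>\<^bsub>K\<^esub> P p q) = L Y) \<and>
      (\<forall>q\<in>?BC. L (pure (fst q) (snd q)) = P p q)"
  proof
    fix p assume p: "p \<in> ?BC"
    obtain L where "L \<in> linear_maps F K K"
      and "\<And>Y g. \<lbrakk>Y \<in> carrier K; g \<in> Y\<rbrakk> \<Longrightarrow>
        (\<Oplus>\<^bsub>K\<^esub>q\<in>{q. g q \<noteq> \<zero>}. g q \<odot>\<^bsub>K\<^esub> P p (fst q, snd q)) = L Y"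
      and "\<And>b c. \<lbrakk>b \<in> carrier B; c \<in> carrier C\<rbrakk> \<Longrightarrow> L (pure b c) = P p (b, c)"
      by (rule tensor_universal[OF K.module_axioms r[OF p]]) (rule that)
    then show "\<exists>L. L \<in> linear_maps F K K \<and>
      (\<forall>Y\<in>carrier K. \<forall>g\<in>Y. (\<Oplus>\<^bsub>K\<^esub>q\<in>{q. g q \<noteq> \<zero>}. g q \<odot>\<^bsub>K\<^esub> P p q) = L Y) \<and>
      (\<forall>q\<in>?BC. L (pure (fst q) (snd q)) = P p q)" by (intro exI[of _ L]) auto
  qed
  then obtain L where L_choice: "\<forall>p\<in>?BC. L p \<in> linear_maps F K K \<and>
      (\<forall>Y\<in>carrier K. \<forall>g\<in>Y. (\<Oplus>\<^bsub>K\<^esub>q\<in>{q. g q \<noteq> \<zero>}. g q \<odot>\<^bsub>K\<^esub> P p q) = L p Y) \<and>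
      (\<forall>q\<in>?BC. L p (pure (fst q) (snd q)) = P p q)"
    by (rule bchoice[THEN exE])
  have L: "L p \<in> linear_maps F K K" if "p \<in> ?BC" for p
    using L_choice that by blast
  have L_sum: "(\<Oplus>\<^bsub>K\<^esub>q\<in>{q. g q \<noteq> \<zero>}. g q \<odot>\<^bsub>K\<^esub> P p q) = L p Y"
    if "p \<in> ?BC" "Y \<in> carrier K" "g \<in> Y" for p Y g
    using bspec[OF L_choice that(1)] that(2,3) by simp
  have L_pure: "L p (pure (fst q) (snd q)) = P p q" if "p \<in> ?BC" "q \<in> ?BC" for p q
    using bspec[OF L_choice that(1)] that(2) by auto
  have supp: "{p. f p \<noteq> \<zero>} \<subseteq> ?BC" "finite {p. f p \<noteq> \<zero>}" "\<And>p. f p \<in> carrier F"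
    if "X \<in> carrier K" "f \<in> X" for X f
  proof -
    have f: "f \<in> carrier free" using tensor_module_memberD(1) that .
    then show "{p. f p \<noteq> \<zero>} \<subseteq> ?BC" "finite {p. f p \<noteq> \<zero>}" by (auto simp: free_module_simps)
    show "f p \<in> carrier F" for p by (rule B.free_module_apply_closed[OF f])
  qed
  have L_bilinear: "(\<lambda>b c. L (b, c) Y) \<in> bilinear_maps F B C K" if Y: "Y \<in> carrier K" for Y
  proof -
    obtain g where g: "g \<in> Y" using tensor_module_carrierE[OF Y] by blast
    \<comment> \<open>With a representative g of Y fixed, L (b, c) Y is a finite sum of multiples of
      maps that \<open>l\<close> declares bilinear.\<close>
    let ?m = "\<lambda>b c. \<Oplus>\<^bsub>K\<^esub>q\<in>{q. g q \<noteq> \<zero>}. g q \<odot>\<^bsub>K\<^esub> P (b, c) q"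
    have m: "?m \<in> bilinear_maps F B C K"
      using supp[OF Y g]
      by (intro bilinear_maps_sum bilinear_maps_scale l B.module_axioms C.module_axioms K.module_axioms) auto
    show ?thesis
    proof (rule bilinear_mapsI)
      fix b assume "b \<in> carrier B"
      then show "(\<lambda>c. L (b, c) Y) \<in> linear_maps F C K"
        using bilinear_maps_right[OF m] L_sum[OF _ Y g]
        by (subst linear_maps_cong[OF C.module_axioms, of _ "?m b"]) auto
    next
      fix c assume "c \<in> carrier C"
      then show "(\<lambda>b. L (b, c) Y) \<in> linear_maps F B K"
        using bilinear_maps_left[OF m] L_sum[OF _ Y g]
        by (subst linear_maps_cong[OF B.module_axioms, of _ "\<lambda>b. ?m b c"]) auto
    qed
  qed
  have "\<forall>Y\<in>carrier K. \<exists>R. R \<in> linear_maps F K K \<and>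
      (\<forall>X\<in>carrier K. \<forall>f\<in>X. (\<Oplus>\<^bsub>K\<^esub>p\<in>{p. f p \<noteq> \<zero>}. f p \<odot>\<^bsub>K\<^esub> L p Y) = R X) \<and>
      (\<forall>p\<in>?BC. R (pure (fst p) (snd p)) = L p Y)"
  proof
    fix Y assume Y: "Y \<in> carrier K"
    obtain R where "R \<in> linear_maps F K K"
      and "\<And>X f. \<lbrakk>X \<in> carrier K; f \<in> X\<rbrakk> \<Longrightarrow>
        (\<Oplus>\<^bsub>K\<^esub>p\<in>{p. f p \<noteq> \<zero>}. f p \<odot>\<^bsub>K\<^esub> L (fst p, snd p) Y) = R X"
      and "\<And>b c. \<lbrakk>b \<in> carrier B; c \<in> carrier C\<rbrakk> \<Longrightarrow> R (pure b c) = L (b, c) Y"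
      by (rule tensor_universal[OF K.module_axioms L_bilinear[OF Y]]) (rule that)
    then show "\<exists>R. R \<in> linear_maps F K K \<and>
      (\<forall>X\<in>carrier K. \<forall>f\<in>X. (\<Oplus>\<^bsub>K\<^esub>p\<in>{p. f p \<noteq> \<zero>}. f p \<odot>\<^bsub>K\<^esub> L p Y) = R X) \<and>
      (\<forall>p\<in>?BC. R (pure (fst p) (snd p)) = L p Y)" by (intro exI[of _ R]) auto
  qed
  then obtain R where R_choice: "\<forall>Y\<in>carrier K. R Y \<in> linear_maps F K K \<and>
      (\<forall>X\<in>carrier K. \<forall>f\<in>X. (\<Oplus>\<^bsub>K\<^esub>p\<in>{p. f p \<noteq> \<zero>}. f p \<odot>\<^bsub>K\<^esub> L p Y) = R Y X) \<and>
      (\<forall>p\<in>?BC. R Y (pure (fst p) (snd p)) = L p Y)"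
    by (rule bchoice[THEN exE])
  have R: "R Y \<in> linear_maps F K K" if "Y \<in> carrier K" for Y
    using R_choice that by blast
  have R_sum: "(\<Oplus>\<^bsub>K\<^esub>p\<in>{p. f p \<noteq> \<zero>}. f p \<odot>\<^bsub>K\<^esub> L p Y) = R Y X"
    if "Y \<in> carrier K" "X \<in> carrier K" "f \<in> X" for Y X f
    using bspec[OF R_choice that(1)] that(2,3) by simp
  have R_pure: "R Y (pure (fst p) (snd p)) = L p Y" if "Y \<in> carrier K" "p \<in> ?BC" for Y p
    using bspec[OF R_choice that(1)] that(2) by auto
  have eq: "tensor_mult F B C P X Y = R Y X" if X: "X \<in> carrier K" and Y: "Y \<in> carrier K" for X Y
  proof -
    have "(\<Oplus>\<^bsub>K\<^esub>p\<in>{p. f p \<noteq> \<zero>}. \<Oplus>\<^bsub>K\<^esub>q\<in>{q. g q \<noteq> \<zero>}. (f p \<otimes> g q) \<odot>\<^bsub>K\<^esub> P p q) = R Y X"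
      if f: "f \<in> X" and g: "g \<in> Y" for f g
    proof -
      have "(\<Oplus>\<^bsub>K\<^esub>q\<in>{q. g q \<noteq> \<zero>}. (f p \<otimes> g q) \<odot>\<^bsub>K\<^esub> P p q) = f p \<odot>\<^bsub>K\<^esub> L p Y"
        if p: "p \<in> {p. f p \<noteq> \<zero>}" for p
      proof -
        have p': "p \<in> ?BC" using supp(1)[OF X f] p by blast
        have Pq: "P p q \<in> carrier K" if "q \<in> {q. g q \<noteq> \<zero>}" for q
          using Pcl[OF p'] supp(1)[OF Y g] that by blast
        have "(\<Oplus>\<^bsub>K\<^esub>q\<in>{q. g q \<noteq> \<zero>}. (f p \<otimes> g q) \<odot>\<^bsub>K\<^esub> P p q)
            = (\<Oplus>\<^bsub>K\<^esub>q\<in>{q. g q \<noteq> \<zero>}. f p \<odot>\<^bsub>K\<^esub> (g q \<odot>\<^bsub>K\<^esub> P p q))"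
          using supp(3)[OF Y g] supp(3)[OF X f] Pq
          by (intro K.M.finsum_cong') (auto simp: K.smult_assoc1)
        also have "\<dots> = f p \<odot>\<^bsub>K\<^esub> (\<Oplus>\<^bsub>K\<^esub>q\<in>{q. g q \<noteq> \<zero>}. g q \<odot>\<^bsub>K\<^esub> P p q)"
          using supp(2,3)[OF Y g] supp(3)[OF X f] Pq
          by (intro K.finsum_smult_ldistr[symmetric]) auto
        finally show ?thesis using L_sum[OF p' Y g] by simp
      qed
      then have "(\<Oplus>\<^bsub>K\<^esub>p\<in>{p. f p \<noteq> \<zero>}. \<Oplus>\<^bsub>K\<^esub>q\<in>{q. g q \<noteq> \<zero>}. (f p \<otimes> g q) \<odot>\<^bsub>K\<^esub> P p q)
          = (\<Oplus>\<^bsub>K\<^esub>p\<in>{p. f p \<noteq> \<zero>}. f p \<odot>\<^bsub>K\<^esub> L p Y)"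
        using supp[OF X f] linear_maps_closed[OF L Y]
        by (intro K.M.finsum_cong') auto
      then show ?thesis using R_sum[OF Y X f] by simp
    qed
    \<comment> \<open>A union over an empty set of representatives would be empty instead of the
      common value.\<close>
    moreover have "X \<noteq> {}" "Y \<noteq> {}"
      using tensor_module_carrierE[OF X] tensor_module_carrierE[OF Y] by blast+
    ultimately show ?thesis unfolding tensor_mult_def Let_def by auto
  qed
  show "tensor_mult F B C P \<in> bilinear_maps F K K K"
  proof (rule bilinear_mapsI)
    fix X assume X: "X \<in> carrier K"
    obtain f where f: "f \<in> X" using tensor_module_carrierE[OF X] by blast
    \<comment> \<open>Linearity of R Y X in Y is not part of the choice of R. With a representative
      f of X fixed, it is read off from the sum of the linear maps L p.\<close>
    have "(\<lambda>Y. \<Oplus>\<^bsub>K\<^esub>p\<in>{p. f p \<noteq> \<zero>}. f p \<odot>\<^bsub>K\<^esub> L p Y) \<in> linear_maps F K K"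
      using supp[OF X f]
      by (intro linear_maps_sum linear_maps_comp[OF L linear_maps_scale] K.module_axioms) auto
    then show "tensor_mult F B C P X \<in> linear_maps F K K"
      using eq[OF X] R_sum[OF _ X f]
      by (subst linear_maps_cong[OF K.module_axioms,
          of _ "\<lambda>Y. \<Oplus>\<^bsub>K\<^esub>p\<in>{p. f p \<noteq> \<zero>}. f p \<odot>\<^bsub>K\<^esub> L p Y"]) auto
  next
    fix Y assume Y: "Y \<in> carrier K"
    show "(\<lambda>X. tensor_mult F B C P X Y) \<in> linear_maps F K K"
      using R[OF Y] eq[OF _ Y] by (subst linear_maps_cong[OF K.module_axioms, of _ "R Y"]) auto
  qed
  show "tensor_mult F B C P (pure b c) (pure b' c') = P (b, c) (b', c')"
    if "b \<in> carrier B" "c \<in> carrier C" "b' \<in> carrier B" "c' \<in> carrier C"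
    using that eq R_pure[of _ "(b, c)"] L_pure[of "(b, c)" "(b', c')"]
      bilinear_maps_closed[OF pure_tensor_bilinear] by simp
qed

subsection \<open>Tensor products of graded modules\<close>

lemma graded_tensor_simps:
  "carrier (graded_tensor F B C P) = carrier (tensor_module F B C)"
  "add (graded_tensor F B C P) = add (tensor_module F B C)"
  "zero (graded_tensor F B C P) = zero (tensor_module F B C)"
  "smult (graded_tensor F B C P) = smult (tensor_module F B C)"
  "mult (graded_tensor F B C P) = tensor_mult F B C P"
  "one (graded_tensor F B C P) = pure_tensor F B C \<one>\<^bsub>B\<^esub> \<one>\<^bsub>C\<^esub>"
  "hom_part (graded_tensor F B C P) (s, t) = module_span F (tensor_module F B C)
    {pure_tensor F B C b c | b c. b \<in> hom_part B s \<and> c \<in> hom_part C t}"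
  by (simp_all add: graded_tensor_def Let_def)

locale graded_tensor_product = B: graded_module F S B + C: graded_module F T C
  for F :: "('f, 'x) ring_scheme" (structure)
    and S :: "('s, 'y) monoid_scheme" and T :: "('t, 'z) monoid_scheme"
    and B :: "('f, 'b, 's) graded_algebra" and C :: "('f, 'c, 't) graded_algebra"
begin

sublocale tensor_product F B C
  by (intro tensor_product.intro B.module_axioms C.module_axioms)

text \<open>For b homogeneous, the c with b \<otimes> c in H form a submodule containing all
  homogeneous c, hence all of C. The same argument then frees b.\<close>

lemma homogeneous_tensor_induct:
  assumes H: "submodule H F K"
    and hom: "\<And>s t b c. \<lbrakk>s \<in> carrier S; t \<in> carrier T; b \<in> hom_part B s; c \<in> hom_part C t\<rbrakk> \<Longrightarrow> pure b c \<in> H"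
  shows "carrier K \<subseteq> H"
proof (rule tensor_induct[OF H])
  have 1: "pure b c \<in> H" if s: "s \<in> carrier S" and b: "b \<in> hom_part B s" and c: "c \<in> carrier C" for s b c
  proof -
    have b': "b \<in> carrier B" using B.hom_part_subset[OF s] b by blast
    have "carrier C \<subseteq> {c \<in> carrier C. pure b c \<in> H}"
      using hom[OF s _ b] C.hom_part_subset
      by (intro C.homogeneous_induct submodule_vimage[OF C.module_axioms K.module_axioms
            bilinear_maps_right[OF pure_tensor_bilinear b'] H]) blast
    then show ?thesis using c by blast
  qed
  fix b c assume b: "b \<in> carrier B" and c: "c \<in> carrier C"
  have "carrier B \<subseteq> {b \<in> carrier B. pure b c \<in> H}"
    using 1[OF _ _ c] B.hom_part_subset
    by (intro B.homogeneous_induct submodule_vimage[OF B.module_axioms K.module_axioms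
          bilinear_maps_left[OF pure_tensor_bilinear c] H]) blast
  then show "pure b c \<in> H" using b by blast
qed

lemma linear_maps_eq_on_homogeneous_tensors:
  assumes "module F Q" and "h \<in> linear_maps F K Q" and "k \<in> linear_maps F K Q"
    and "\<And>s t b c. \<lbrakk>s \<in> carrier S; t \<in> carrier T; b \<in> hom_part B s; c \<in> hom_part C t\<rbrakk> \<Longrightarrow>
      h (pure b c) = k (pure b c)"
    and "X \<in> carrier K"
  shows "h X = k X"
proof -
  have "pure b c \<in> carrier K" if "s \<in> carrier S" "t \<in> carrier T" "b \<in> hom_part B s" "c \<in> hom_part C t"
    for s t b c
    using that B.hom_part_subset C.hom_part_subset
    by (blast intro: bilinear_maps_closed[OF pure_tensor_bilinear])
  then have "carrier K \<subseteq> {X \<in> carrier K. h X = k X}"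
    using assms(4)
    by (intro homogeneous_tensor_induct submodule_equalizer[OF K.module_axioms assms(1-3)]) blast
  then show ?thesis using assms(5) by blast
qed

lemma pure_in_hom_part:
  "\<lbrakk>b \<in> hom_part B s; c \<in> hom_part C t\<rbrakk> \<Longrightarrow> pure b c \<in> hom_part (graded_tensor F B C P) (s, t)"
  unfolding graded_tensor_simps by (rule subsetD[OF module_span_superset]) blast

text \<open>The universal property turns the bilinear map that sends (b, c) to the tensor of their
  components of degrees s and t into a projection onto the part of degree (s, t). These projections
  make the sum direct. P is arbitrary, since a grading of the module does not involve the
  product.\<close>

lemma graded_tensor_graded_module: "graded_module F (S \<times>\<times> T) (graded_tensor F B C P)"
proof -
  let ?A = "graded_tensor F B C P"
  note change = graded_tensor_simps(1-4)[of F B C P]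
  have lin_change: "linear_maps F ?A ?A = linear_maps F K K"
    by (rule linear_maps_change) (simp_all add: change)
  have sub_change: "submodule H F ?A \<longleftrightarrow> submodule H F K" for H
    by (rule submodule_change[OF change])
  let ?gen = "\<lambda>s t. {pure b c | b c. b \<in> hom_part B s \<and> c \<in> hom_part C t}"
  have gen_carrier: "?gen s t \<subseteq> carrier K" if "s \<in> carrier S" "t \<in> carrier T" for s t
    using that B.hom_part_subset C.hom_part_subset
    by (auto intro!: bilinear_maps_closed[OF pure_tensor_bilinear])
  have sub: "submodule (hom_part ?A (s, t)) F K" if "s \<in> carrier S" "t \<in> carrier T" for s t
    unfolding graded_tensor_simps by (rule K.module_span_submodule[OF gen_carrier[OF that]])
  have "\<exists>p. p \<in> linear_maps F K K \<and> (\<forall>b\<in>carrier B. \<forall>c\<in>carrier C.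
      p (pure b c) = pure (hom_comp S B b s) (hom_comp T C c t))"
    if "s \<in> carrier S" "t \<in> carrier T" for s t
  proof -
    have m: "(\<lambda>b c. pure (hom_comp S B b s) (hom_comp T C c t)) \<in> bilinear_maps F B C K"
      by (rule bilinear_maps_comp[OF pure_tensor_bilinear B.hom_comp_linear[OF that(1)]
            C.hom_comp_linear[OF that(2)] linear_maps_id])
    obtain L where "L \<in> linear_maps F K K" and
      "\<And>b c. \<lbrakk>b \<in> carrier B; c \<in> carrier C\<rbrakk> \<Longrightarrow> L (pure b c) = pure (hom_comp S B b s) (hom_comp T C c t)"
      by (rule tensor_universal[OF K.module_axioms m]) (rule that)
    then show ?thesis by (intro exI[of _ L]) auto
  qed
  then have "\<forall>x\<in>carrier (S \<times>\<times> T). \<exists>p. p \<in> linear_maps F K K \<and> (\<forall>b\<in>carrier B. \<forall>c\<in>carrier C.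
      p (pure b c) = pure (hom_comp S B b (fst x)) (hom_comp T C c (snd x)))"
    by auto
  then obtain p where p_choice: "\<forall>x\<in>carrier (S \<times>\<times> T). p x \<in> linear_maps F K K \<and>
      (\<forall>b\<in>carrier B. \<forall>c\<in>carrier C.
        p x (pure b c) = pure (hom_comp S B b (fst x)) (hom_comp T C c (snd x)))"
    by (rule bchoice[THEN exE])
  have p: "p (s, t) \<in> linear_maps F K K" if "s \<in> carrier S" "t \<in> carrier T" for s t
    using bspec[OF p_choice, of "(s, t)"] that by simp
  have p_pure: "p (s, t) (pure b c) = pure (hom_comp S B b s) (hom_comp T C c t)"
    if "s \<in> carrier S" "t \<in> carrier T" "b \<in> carrier B" "c \<in> carrier C" for s t b c
    using bspec[OF p_choice, of "(s, t)"] that by simp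
  \<comment> \<open>A homogeneous pure tensor is killed by every projection to another degree,
    because at least one of its two components vanishes.\<close>
  have pure_zero: "pure \<zero>\<^bsub>B\<^esub> c = \<zero>\<^bsub>K\<^esub>" "pure b \<zero>\<^bsub>C\<^esub> = \<zero>\<^bsub>K\<^esub>" if "b \<in> carrier B" "c \<in> carrier C" for b c
    using linear_maps_zero[OF B.module_axioms K.module_axioms bilinear_maps_left[OF pure_tensor_bilinear that(2)]]
      linear_maps_zero[OF C.module_axioms K.module_axioms bilinear_maps_right[OF pure_tensor_bilinear that(1)]]
    by simp_all
  show ?thesis
  proof (rule graded_moduleI[where p = p])
    show "module F ?A" by (rule module_change[OF K.module_axioms change])
  next
    fix x assume "x \<in> carrier (S \<times>\<times> T)"
    then obtain s t where x: "x = (s, t)" "s \<in> carrier S" "t \<in> carrier T" by auto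
    then show "submodule (hom_part ?A x) F ?A" "p x \<in> linear_maps F ?A ?A"
      using sub p by (simp_all add: sub_change lin_change)
    fix X assume "X \<in> carrier ?A"
    then have X: "X \<in> carrier K" by (simp add: change)
    have "pure (hom_comp S B b s) (hom_comp T C c t) \<in> hom_part ?A (s, t)"
      if "b \<in> carrier B" "c \<in> carrier C" for b c
      by (rule pure_in_hom_part[OF B.hom_comp_in_hom_part[OF that(1) x(2)]
            C.hom_comp_in_hom_part[OF that(2) x(3)]])
    then have "carrier K \<subseteq> {X \<in> carrier K. p (s, t) X \<in> hom_part ?A (s, t)}"
      using p_pure[OF x(2,3)] bilinear_maps_closed[OF pure_tensor_bilinear]
      by (intro tensor_induct submodule_vimage[OF K.module_axioms K.module_axioms p sub] x) auto
    then show "p x X \<in> hom_part ?A x" using X x(1) by blast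
  next
    fix x y X assume "x \<in> carrier (S \<times>\<times> T)" "y \<in> carrier (S \<times>\<times> T)" and X: "X \<in> hom_part ?A x"
    then obtain s t s' t' where x: "x = (s, t)" "s \<in> carrier S" "t \<in> carrier T"
      and y: "y = (s', t')" "s' \<in> carrier S" "t' \<in> carrier T" by auto
    \<comment> \<open>Writing the expected value as a linear map turns the claim into equality of
      two linear maps, which can be checked on the generators of the part.\<close>
    let ?q = "\<lambda>X. if y = x then X else \<zero>\<^bsub>K\<^esub>"
    have q: "?q \<in> linear_maps F K K"
      using linear_maps_id linear_maps_const_zero[OF K.module_axioms] by (cases "y = x") auto
    have "p (s', t') (pure b c) = ?q (pure b c)" if b: "b \<in> hom_part B s" and c: "c \<in> hom_part C t" for b c
    proof -
      have "b \<in> carrier B" "c \<in> carrier C" using b c B.hom_part_subset C.hom_part_subset x by blast+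
      then show ?thesis
        using p_pure[OF y(2,3)] B.hom_comp_homogeneous[OF x(2) y(2) b] C.hom_comp_homogeneous[OF x(3) y(3) c]
          pure_zero x(1) y(1) by auto
    qed
    then have "?gen s t \<subseteq> {X \<in> carrier K. p (s', t') X = ?q X}"
      using subsetD[OF gen_carrier[OF x(2,3)]] by blast
    then have "hom_part ?A (s, t) \<subseteq> {X \<in> carrier K. p (s', t') X = ?q X}"
      unfolding graded_tensor_simps
      by (intro module_span_minimal submodule_equalizer[OF K.module_axioms K.module_axioms p q] y)
    then show "p y X = (if y = x then X else \<zero>\<^bsub>?A\<^esub>)" using X x(1) y(1) by (auto simp: change)
  next
    fix H assume H: "submodule H F ?A" and hom: "\<And>x. x \<in> carrier (S \<times>\<times> T) \<Longrightarrow> hom_part ?A x \<subseteq> H"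
    have "pure b c \<in> H" if "s \<in> carrier S" "t \<in> carrier T" "b \<in> hom_part B s" "c \<in> hom_part C t" for s t b c
      using hom[of "(s, t)"] pure_in_hom_part[OF that(3,4)] that(1,2) by auto
    then show "carrier ?A \<subseteq> H"
      using homogeneous_tensor_induct[of H] H by (simp add: sub_change change)
  qed
qed

section \<open>The classical and the twisted product of tensors\<close>

lemma tensor_algebra_mult:
  assumes B: "mult B \<in> bilinear_maps F B B B" and C: "mult C \<in> bilinear_maps F C C C"
  shows tensor_algebra_mult_bilinear: "mult (tensor_algebra F B C) \<in> bilinear_maps F K K K"
    and tensor_algebra_mult_pure: "\<lbrakk>b \<in> carrier B; c \<in> carrier C; b' \<in> carrier B; c' \<in> carrier C\<rbrakk> \<Longrightarrow>
      pure b c \<otimes>\<^bsub>tensor_algebra F B C\<^esub> pure b' c' = pure (b \<otimes>\<^bsub>B\<^esub> b') (c \<otimes>\<^bsub>C\<^esub> c')"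
proof -
  let ?P = "\<lambda>(b, c) (b', c'). pure (b \<otimes>\<^bsub>B\<^esub> b') (c \<otimes>\<^bsub>C\<^esub> c')"
  have l: "(\<lambda>b c. ?P (b, c) q) \<in> bilinear_maps F B C K" if "q \<in> carrier B \<times> carrier C" for q
  proof (cases q)
    case (Pair b' c')
    then show ?thesis
      using bilinear_maps_comp[OF pure_tensor_bilinear bilinear_maps_left[OF B, of b']
          bilinear_maps_left[OF C, of c'] linear_maps_id] that by simp
  qed
  have r: "(\<lambda>b c. ?P p (b, c)) \<in> bilinear_maps F B C K" if "p \<in> carrier B \<times> carrier C" for p
  proof (cases p)
    case (Pair b c)
    then show ?thesis
      using bilinear_maps_comp[OF pure_tensor_bilinear bilinear_maps_right[OF B, of b]
          bilinear_maps_right[OF C, of c] linear_maps_id] that by simp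
  qed
  show "mult (tensor_algebra F B C) \<in> bilinear_maps F K K K"
    unfolding tensor_algebra_def graded_tensor_simps by (rule tensor_mult_bilinear[OF l r])
  show "pure b c \<otimes>\<^bsub>tensor_algebra F B C\<^esub> pure b' c' = pure (b \<otimes>\<^bsub>B\<^esub> b') (c \<otimes>\<^bsub>C\<^esub> c')"
    if "b \<in> carrier B" "c \<in> carrier C" "b' \<in> carrier B" "c' \<in> carrier C"
    unfolding tensor_algebra_def graded_tensor_simps using tensor_mult_pure[OF l r that] by simp
qed

text \<open>Only the inner factors c and b' are decomposed. So \<open>?E\<close> is bilinear in (b',
  c) by gluing over degrees, and linear in each outer factor b and c' term by term.\<close>

lemma twisted_tensor_mult:
  assumes B: "mult B \<in> bilinear_maps F B B B" and C: "mult C \<in> bilinear_maps F C C C"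
    and \<alpha>: "\<And>s t. \<lbrakk>s \<in> carrier S; t \<in> carrier T\<rbrakk> \<Longrightarrow> \<alpha> (s, t) \<in> carrier F"
  shows twisted_tensor_mult_bilinear: "mult (twisted_tensor F S T B C \<alpha>) \<in> bilinear_maps F K K K"
    and twisted_tensor_mult_pure:
      "\<lbrakk>b \<in> carrier B; c \<in> hom_part C t; b' \<in> hom_part B s; c' \<in> carrier C; s \<in> carrier S; t \<in> carrier T\<rbrakk> \<Longrightarrow>
      pure b c \<otimes>\<^bsub>twisted_tensor F S T B C \<alpha>\<^esub> pure b' c' = \<alpha> (s, t) \<odot>\<^bsub>K\<^esub> pure (b \<otimes>\<^bsub>B\<^esub> b') (c \<otimes>\<^bsub>C\<^esub> c')"
proof -
  let ?E = "\<lambda>b c b' c'. \<Oplus>\<^bsub>K\<^esub>s\<in>hom_supp S B b'. \<Oplus>\<^bsub>K\<^esub>t\<in>hom_supp T C c.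
    \<alpha> (s, t) \<odot>\<^bsub>K\<^esub> pure (b \<otimes>\<^bsub>B\<^esub> hom_comp S B b' s) (hom_comp T C c t \<otimes>\<^bsub>C\<^esub> c')"
  let ?P = "\<lambda>(b, c) (b', c'). ?E b c b' c'"
  note scale = linear_maps_scale[OF K.module_axioms \<alpha>]
  have g: "(\<lambda>b' c. \<alpha> (s, t) \<odot>\<^bsub>K\<^esub> pure (b \<otimes>\<^bsub>B\<^esub> b') (c \<otimes>\<^bsub>C\<^esub> c')) \<in> bilinear_maps F B C K"
    if "b \<in> carrier B" "c' \<in> carrier C" "s \<in> carrier S" "t \<in> carrier T" for b c' s t
    by (rule bilinear_maps_comp[OF pure_tensor_bilinear bilinear_maps_right[OF B that(1)]
          bilinear_maps_left[OF C that(2)] scale[OF that(3,4)]])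
  note ext = graded_bilinear_extension[OF B.graded_module_axioms C.graded_module_axioms K.module_axioms g]
  have inner: "(\<lambda>b' c. ?E b c b' c') \<in> bilinear_maps F B C K" if "b \<in> carrier B" "c' \<in> carrier C" for b c'
    by (rule ext(1)[OF that])
  have left: "(\<lambda>b. ?E b c b' c') \<in> linear_maps F B K"
    if "c \<in> carrier C" "b' \<in> carrier B" "c' \<in> carrier C" for c b' c'
  proof (intro linear_maps_sum[OF B.module_axioms K.module_axioms])
    fix s t assume "s \<in> hom_supp S B b'" "t \<in> hom_supp T C c"
    then have s: "s \<in> carrier S" and t: "t \<in> carrier T"
      using B.hom_supp_subset C.hom_supp_subset by blast+
    have "hom_comp T C c t \<otimes>\<^bsub>C\<^esub> c' \<in> carrier C"
      by (rule bilinear_maps_closed[OF C C.hom_comp_closed[OF that(1) t] that(3)])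
    from linear_maps_comp[OF linear_maps_comp[OF
          bilinear_maps_left[OF B B.hom_comp_closed[OF that(2) s]]
          bilinear_maps_left[OF pure_tensor_bilinear this]] scale[OF s t]]
    show "(\<lambda>b. \<alpha> (s, t) \<odot>\<^bsub>K\<^esub> pure (b \<otimes>\<^bsub>B\<^esub> hom_comp S B b' s) (hom_comp T C c t \<otimes>\<^bsub>C\<^esub> c'))
        \<in> linear_maps F B K" .
  qed
  have right: "(\<lambda>c'. ?E b c b' c') \<in> linear_maps F C K"
    if "b \<in> carrier B" "c \<in> carrier C" "b' \<in> carrier B" for b c b'
  proof (intro linear_maps_sum[OF C.module_axioms K.module_axioms])
    fix s t assume "s \<in> hom_supp S B b'" "t \<in> hom_supp T C c"
    then have s: "s \<in> carrier S" and t: "t \<in> carrier T"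
      using B.hom_supp_subset C.hom_supp_subset by blast+
    have "b \<otimes>\<^bsub>B\<^esub> hom_comp S B b' s \<in> carrier B"
      by (rule bilinear_maps_closed[OF B that(1) B.hom_comp_closed[OF that(3) s]])
    from linear_maps_comp[OF linear_maps_comp[OF
          bilinear_maps_right[OF C C.hom_comp_closed[OF that(2) t]]
          bilinear_maps_right[OF pure_tensor_bilinear this]] scale[OF s t]]
    show "(\<lambda>c'. \<alpha> (s, t) \<odot>\<^bsub>K\<^esub> pure (b \<otimes>\<^bsub>B\<^esub> hom_comp S B b' s) (hom_comp T C c t \<otimes>\<^bsub>C\<^esub> c'))
        \<in> linear_maps F C K" .
  qed
  \<comment> \<open>The pairs are regrouped: \<open>tensor_mult\<close> needs bilinearity in (b, c)
    and in (b', c'), each of which combines one outer factor with one inner factor.\<close>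
  have l: "(\<lambda>b c. ?P (b, c) q) \<in> bilinear_maps F B C K" if q_in: "q \<in> carrier B \<times> carrier C" for q
  proof -
    obtain b' c' where q: "q = (b', c')" "b' \<in> carrier B" "c' \<in> carrier C" using q_in by auto
    show ?thesis unfolding q(1) prod.case
      using left[OF _ q(2,3)] bilinear_maps_right[OF inner[OF _ q(3)] q(2)] by (rule bilinear_mapsI[rotated])
  qed
  have r: "(\<lambda>b c. ?P p (b, c)) \<in> bilinear_maps F B C K" if p_in: "p \<in> carrier B \<times> carrier C" for p
  proof -
    obtain b c where p: "p = (b, c)" "b \<in> carrier B" "c \<in> carrier C" using p_in by auto
    show ?thesis unfolding p(1) prod.case
      using right[OF p(2,3)] bilinear_maps_left[OF inner[OF p(2)] p(3)] by (rule bilinear_mapsI)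
  qed
  show "mult (twisted_tensor F S T B C \<alpha>) \<in> bilinear_maps F K K K"
    unfolding twisted_tensor_def graded_tensor_simps by (rule tensor_mult_bilinear[OF l r])
  show "pure b c \<otimes>\<^bsub>twisted_tensor F S T B C \<alpha>\<^esub> pure b' c' = \<alpha> (s, t) \<odot>\<^bsub>K\<^esub> pure (b \<otimes>\<^bsub>B\<^esub> b') (c \<otimes>\<^bsub>C\<^esub> c')"
    if b: "b \<in> carrier B" and c: "c \<in> hom_part C t" and b': "b' \<in> hom_part B s" and c': "c' \<in> carrier C"
      and s: "s \<in> carrier S" and t: "t \<in> carrier T"
  proof -
    have "c \<in> carrier C" "b' \<in> carrier B"
      using c b' B.hom_part_subset[OF s] C.hom_part_subset[OF t] by blast+
    then have "pure b c \<otimes>\<^bsub>twisted_tensor F S T B C \<alpha>\<^esub> pure b' c' = ?E b c b' c'"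
      unfolding twisted_tensor_def graded_tensor_simps using tensor_mult_pure[OF l r b _ _ c'] by simp
    also have "\<dots> = \<alpha> (s, t) \<odot>\<^bsub>K\<^esub> pure (b \<otimes>\<^bsub>B\<^esub> b') (c \<otimes>\<^bsub>C\<^esub> c')"
      by (rule ext(2)[OF b c' _ _ s t b' c])
    finally show ?thesis .
  qed
qed

end

subsection \<open>The Yamazaki factorization\<close>

lemma cocyclesD:
  assumes "\<mu> \<in> cocycles F S"
  shows cocycle_Units: "\<lbrakk>x \<in> carrier S; y \<in> carrier S\<rbrakk> \<Longrightarrow> \<mu> (x, y) \<in> Units F"
    and cocycle_assoc: "\<lbrakk>x \<in> carrier S; y \<in> carrier S; z \<in> carrier S\<rbrakk> \<Longrightarrow>
      \<mu> (x, y \<otimes>\<^bsub>S\<^esub> z) \<otimes>\<^bsub>F\<^esub> \<mu> (y, z) = \<mu> (x, y) \<otimes>\<^bsub>F\<^esub> \<mu> (x \<otimes>\<^bsub>S\<^esub> y, z)"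
    and cocycle_one: "x \<in> carrier S \<Longrightarrow> \<mu> (x, \<one>\<^bsub>S\<^esub>) = \<one>\<^bsub>F\<^esub>"
  using assms by (auto simp: cocycles_def)

text \<open>Write a = (s, e), b = (e, t), c = (s', e) and d = (e, t'). The cocycle equation is used
  for the triples (a, b, cd), (b, c, d), (c, b, d) and (a, c, bd). Since bc = cb = (s', t), the
  second and third share the factor \<mu>(bc, d), and passing from one to the other exchanges
  \<mu>(b, c) for \<mu>(c, b).\<close>

lemma yamazaki_factorization:
  assumes "cring F" and "Group.monoid S" and "Group.monoid T"
    and \<mu>: "\<mu> \<in> cocycles F (S \<times>\<times> T)" and \<alpha>: "\<alpha> \<in> pairings F S T"
    and Y: "yamazaki F S T \<mu> = (\<nu>, \<xi>, pairing_inv F S T \<alpha>)"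
    and s: "s \<in> carrier S" "s' \<in> carrier S" and t: "t \<in> carrier T" "t' \<in> carrier T"
  defines "\<gamma> \<equiv> \<lambda>(s, t). \<mu> ((s, \<one>\<^bsub>T\<^esub>), (\<one>\<^bsub>S\<^esub>, t))"
  shows "\<gamma> (s, t) \<otimes>\<^bsub>F\<^esub> \<gamma> (s', t') \<otimes>\<^bsub>F\<^esub> \<mu> ((s, t), (s', t')) =
    \<alpha> (s', t) \<otimes>\<^bsub>F\<^esub> \<nu> (s, s') \<otimes>\<^bsub>F\<^esub> \<xi> (t, t') \<otimes>\<^bsub>F\<^esub> \<gamma> (s \<otimes>\<^bsub>S\<^esub> s', t \<otimes>\<^bsub>T\<^esub> t')"
proof -
  interpret cring F by fact
  interpret S: Group.monoid S by fact
  interpret T: Group.monoid T by fact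
  let ?G = "S \<times>\<times> T"
  let ?a = "(s, \<one>\<^bsub>T\<^esub>)" and ?b = "(\<one>\<^bsub>S\<^esub>, t)" and ?c = "(s', \<one>\<^bsub>T\<^esub>)" and ?d = "(\<one>\<^bsub>S\<^esub>, t')"
  note U = cocycle_Units[OF \<mu>]
  have cl: "\<mu> ((x, y), (z, w)) \<in> carrier F"
    if "x \<in> carrier S" "z \<in> carrier S" "y \<in> carrier T" "w \<in> carrier T" for x y z w
    using U[of "(x, y)" "(z, w)"] that by (simp add: Units_closed)
  have \<nu>: "\<nu> (s, s') = \<mu> (?a, ?c)" and \<xi>: "\<xi> (t, t') = \<mu> (?b, ?d)"
    using Y s t by (auto simp: yamazaki_def)
  have \<alpha>U: "\<alpha> (s', t) \<in> Units F" using \<alpha> s t by (auto simp: pairings_def)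
  have \<alpha>_eq: "snd (snd (yamazaki F S T \<mu>)) = pairing_inv F S T \<alpha>" by (simp add: Y)
  have "inv\<^bsub>F\<^esub> (\<alpha> (s', t)) = \<mu> (?c, ?b) \<otimes>\<^bsub>F\<^esub> inv\<^bsub>F\<^esub> (\<mu> (?b, ?c))"
    using fun_cong[OF \<alpha>_eq, of "(s', t)"] s t by (simp add: yamazaki_def pairing_inv_def)
  moreover have Ubc: "\<mu> (?b, ?c) \<in> Units F" and Ucb: "\<mu> (?c, ?b) \<in> Units F"
    using U[of ?b ?c] U[of ?c ?b] s t by simp_all
  \<comment> \<open>The third component of the factorization at (s', t) reads \<mu>(c, b) / \<mu>(b,
    c) = 1 / \<alpha>(s', t).\<close>
  ultimately have swap: "\<mu> (?b, ?c) = \<alpha> (s', t) \<otimes>\<^bsub>F\<^esub> \<mu> (?c, ?b)"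
  proof -
    assume inv: "inv\<^bsub>F\<^esub> (\<alpha> (s', t)) = \<mu> (?c, ?b) \<otimes>\<^bsub>F\<^esub> inv\<^bsub>F\<^esub> (\<mu> (?b, ?c))"
    have "\<alpha> (s', t) \<otimes>\<^bsub>F\<^esub> \<mu> (?c, ?b)
        = \<alpha> (s', t) \<otimes>\<^bsub>F\<^esub> (\<mu> (?c, ?b) \<otimes>\<^bsub>F\<^esub> inv\<^bsub>F\<^esub> (\<mu> (?b, ?c))) \<otimes>\<^bsub>F\<^esub> \<mu> (?b, ?c)"
      using \<alpha>U Ubc Ucb by (simp add: Units_closed m_assoc)
    also have "\<dots> = \<mu> (?b, ?c)"
      unfolding inv[symmetric] using \<alpha>U Ubc by (simp add: Units_closed)
    finally show ?thesis by simp
  qed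
  have coc: "\<mu> ((x, y), (x' \<otimes>\<^bsub>S\<^esub> x'', y' \<otimes>\<^bsub>T\<^esub> y'')) \<otimes>\<^bsub>F\<^esub> \<mu> ((x', y'), (x'', y'')) =
      \<mu> ((x, y), (x', y')) \<otimes>\<^bsub>F\<^esub> \<mu> ((x \<otimes>\<^bsub>S\<^esub> x', y \<otimes>\<^bsub>T\<^esub> y'), (x'', y''))"
    if "x \<in> carrier S" "x' \<in> carrier S" "x'' \<in> carrier S" "y \<in> carrier T" "y' \<in> carrier T" "y'' \<in> carrier T"
    for x x' x'' y y' y''
    using cocycle_assoc[OF \<mu>, of "(x, y)" "(x', y')" "(x'', y'')"] that by simp
  note [simp] = cl s t
  let ?ss = "s \<otimes>\<^bsub>S\<^esub> s'" and ?tt = "t \<otimes>\<^bsub>T\<^esub> t'"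
  have 1: "\<mu> (?a, (s', ?tt)) \<otimes>\<^bsub>F\<^esub> \<mu> (?b, (s', t')) = \<mu> (?a, ?b) \<otimes>\<^bsub>F\<^esub> \<mu> ((s, t), (s', t'))"
    using coc[of s "\<one>\<^bsub>S\<^esub>" s' "\<one>\<^bsub>T\<^esub>" t t'] by simp
  have 2: "\<mu> (?b, (s', t')) \<otimes>\<^bsub>F\<^esub> \<mu> (?c, ?d) = \<mu> (?b, ?c) \<otimes>\<^bsub>F\<^esub> \<mu> ((s', t), ?d)"
    using coc[of "\<one>\<^bsub>S\<^esub>" s' "\<one>\<^bsub>S\<^esub>" t "\<one>\<^bsub>T\<^esub>" t'] by simp
  have 3: "\<mu> (?c, (\<one>\<^bsub>S\<^esub>, ?tt)) \<otimes>\<^bsub>F\<^esub> \<mu> (?b, ?d) = \<mu> (?c, ?b) \<otimes>\<^bsub>F\<^esub> \<mu> ((s', t), ?d)"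
    using coc[of s' "\<one>\<^bsub>S\<^esub>" "\<one>\<^bsub>S\<^esub>" "\<one>\<^bsub>T\<^esub>" t t'] by simp
  have 4: "\<mu> (?a, (s', ?tt)) \<otimes>\<^bsub>F\<^esub> \<mu> (?c, (\<one>\<^bsub>S\<^esub>, ?tt)) = \<mu> (?a, ?c) \<otimes>\<^bsub>F\<^esub> \<mu> ((?ss, \<one>\<^bsub>T\<^esub>), (\<one>\<^bsub>S\<^esub>, ?tt))"
    using coc[of s s' "\<one>\<^bsub>S\<^esub>" "\<one>\<^bsub>T\<^esub>" "\<one>\<^bsub>T\<^esub>" ?tt] by simp
  have \<alpha>cl: "\<alpha> (s', t) \<in> carrier F" using \<alpha>U by (rule Units_closed)
  \<comment> \<open>The chain applies equations 1, 2 with \<open>swap\<close>, 3 and 4 in turn. Each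
    replaces a product of two values of \<mu> by another such product, so nothing has to be
    cancelled.\<close>
  have "\<mu> (?a, ?b) \<otimes>\<^bsub>F\<^esub> \<mu> (?c, ?d) \<otimes>\<^bsub>F\<^esub> \<mu> ((s, t), (s', t'))
      = (\<mu> (?a, ?b) \<otimes>\<^bsub>F\<^esub> \<mu> ((s, t), (s', t'))) \<otimes>\<^bsub>F\<^esub> \<mu> (?c, ?d)"
    by (simp add: m_ac)
  also have "\<dots> = \<mu> (?a, (s', ?tt)) \<otimes>\<^bsub>F\<^esub> (\<mu> (?b, (s', t')) \<otimes>\<^bsub>F\<^esub> \<mu> (?c, ?d))"
    by (simp add: 1[symmetric] m_assoc)
  also have "\<dots> = \<mu> (?a, (s', ?tt)) \<otimes>\<^bsub>F\<^esub> (\<alpha> (s', t) \<otimes>\<^bsub>F\<^esub> (\<mu> (?c, ?b) \<otimes>\<^bsub>F\<^esub> \<mu> ((s', t), ?d)))"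
    unfolding 2 swap by (simp add: m_assoc \<alpha>cl)
  also have "\<dots> = \<alpha> (s', t) \<otimes>\<^bsub>F\<^esub> \<mu> (?b, ?d) \<otimes>\<^bsub>F\<^esub> (\<mu> (?a, (s', ?tt)) \<otimes>\<^bsub>F\<^esub> \<mu> (?c, (\<one>\<^bsub>S\<^esub>, ?tt)))"
    unfolding 3[symmetric] by (simp add: m_ac \<alpha>cl)
  also have "\<dots> = \<alpha> (s', t) \<otimes>\<^bsub>F\<^esub> \<mu> (?a, ?c) \<otimes>\<^bsub>F\<^esub> \<mu> (?b, ?d) \<otimes>\<^bsub>F\<^esub> \<mu> ((?ss, \<one>\<^bsub>T\<^esub>), (\<one>\<^bsub>S\<^esub>, ?tt))"
    unfolding 4 by (simp add: m_ac \<alpha>cl)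
  finally show ?thesis by (simp add: \<gamma>_def \<nu> \<xi>)
qed

section \<open>The graded isomorphism\<close>

theorem proposition3p9:
  fixes F :: "('f, 'x) ring_scheme"
    and S :: "('s, 'y) monoid_scheme" and T :: "('t, 'z) monoid_scheme"
    and B :: "('f, 'b, 's) graded_algebra" and C :: "('f, 'c, 't) graded_algebra"
    and \<mu> :: "('s \<times> 't) \<times> ('s \<times> 't) \<Rightarrow> 'f"
    and \<nu> :: "'s \<times> 's \<Rightarrow> 'f" and \<xi> :: "'t \<times> 't \<Rightarrow> 'f" and \<alpha> :: "'s \<times> 't \<Rightarrow> 'f"
  assumes "field F" and "Group.monoid S" and "Group.monoid T"
    and "graded_algebra F S B" and "graded_algebra F T C"
    and "\<mu> \<in> cocycles F (S \<times>\<times> T)"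
    and "\<nu> \<in> cocycles F S" and "\<xi> \<in> cocycles F T" and "\<alpha> \<in> pairings F S T"
    and "yamazaki F S T \<mu> = (\<nu>, \<xi>, pairing_inv F S T \<alpha>)"
  shows "graded_isomorphic F (S \<times>\<times> T)
    (twist (S \<times>\<times> T) (tensor_algebra F B C) \<mu>)
    (twisted_tensor F S T (twist S B \<nu>) (twist T C \<xi>) \<alpha>)"
proof -
  interpret F: field F by fact
  interpret S: Group.monoid S by fact
  interpret T: Group.monoid T by fact
  interpret B: graded_algebra F S B by fact
  interpret C: graded_algebra F T C by fact
  let ?G = "S \<times>\<times> T" and ?B = "twist S B \<nu>" and ?C = "twist T C \<xi>"
  let ?A = "tensor_algebra F B C" and ?D = "twisted_tensor F S T ?B ?C \<alpha>"
  let ?K = "tensor_module F B C" and ?pure = "pure_tensor F B C"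
  note gB = graded_algebra_imp_graded_module[OF assms(4)]
    and gC = graded_algebra_imp_graded_module[OF assms(5)]
  interpret BC: graded_tensor_product F S T B C
    by (intro graded_tensor_product.intro gB gC)
  \<comment> \<open>The target is built on the twisted factors and needs its own instance;
    \<open>twist_tensor_module\<close> identifies its module with that of \<open>BC\<close>.\<close>
  interpret BC': graded_tensor_product F S T ?B ?C
    by (intro graded_tensor_product.intro twist_graded_module gB gC)
  note \<mu>U = cocycle_Units[OF assms(6)] and \<nu>U = cocycle_Units[OF assms(7)]
    and \<xi>U = cocycle_Units[OF assms(8)]
  have \<alpha>U: "\<alpha> (s, t) \<in> Units F" if "s \<in> carrier S" "t \<in> carrier T" for s t
    using assms(9) that by (auto simp: pairings_def)
  note mB = graded_algebra_mult_bilinear[OF assms(4)] and mC = graded_algebra_mult_bilinear[OF assms(5)]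
  note twB = twist_mult[where \<mu> = \<nu>, OF gB mB F.Units_closed[OF \<nu>U]]
    and twC = twist_mult[where \<mu> = \<xi>, OF gC mC F.Units_closed[OF \<xi>U]]
  have mB': "mult ?B \<in> bilinear_maps F ?B ?B ?B" and mC': "mult ?C \<in> bilinear_maps F ?C ?C ?C"
    using twB(1) twC(1)
    by (simp_all add: twist_simps bilinear_maps_change[of ?B B ?B B ?B B] bilinear_maps_change[of ?C C ?C C ?C C])
  have A_simps: "carrier ?A = carrier ?K" "add ?A = add ?K" "smult ?A = smult ?K" "zero ?A = zero ?K"
    by (simp_all add: tensor_algebra_def graded_tensor_simps)
  have D_simps: "carrier ?D = carrier ?K" "add ?D = add ?K" "smult ?D = smult ?K" "zero ?D = zero ?K"
    by (simp_all add: twisted_tensor_def twist_tensor_module graded_tensor_simps)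
  have one: "\<one>\<^bsub>?A\<^esub> = ?pure \<one>\<^bsub>B\<^esub> \<one>\<^bsub>C\<^esub>" "\<one>\<^bsub>?D\<^esub> = ?pure \<one>\<^bsub>B\<^esub> \<one>\<^bsub>C\<^esub>"
    by (simp_all add: tensor_algebra_def twisted_tensor_def twist_tensor_module graded_tensor_simps)
  have part: "hom_part ?D = hom_part ?A"
    by (simp add: fun_eq_iff tensor_algebra_def twisted_tensor_def twist_tensor_module graded_tensor_simps)
  have gA: "graded_module F ?G ?A"
    unfolding tensor_algebra_def by (rule BC.graded_tensor_graded_module)
  interpret A: graded_module F ?G ?A by (rule gA)
  have lin_A: "linear_maps F ?A ?A = linear_maps F ?K ?K"
    and bil_A: "bilinear_maps F ?A ?A ?A = bilinear_maps F ?K ?K ?K"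
    by (intro linear_maps_change bilinear_maps_change A_simps)+
  have pure_part: "?pure b c \<in> hom_part ?A (s, t)" if "b \<in> hom_part B s" "c \<in> hom_part C t" for b c s t
    unfolding tensor_algebra_def by (rule BC.pure_in_hom_part[OF that])
  note mA = BC.tensor_algebra_mult[OF mB mC]
  have mA1: "mult ?A \<in> bilinear_maps F ?A ?A ?A" unfolding bil_A by (rule mA(1))
  note twA = twist_mult[where \<mu> = \<mu>, OF gA mA1 F.Units_closed[OF \<mu>U]]
  let ?m1 = "mult (twist ?G ?A \<mu>)" and ?m2 = "mult ?D"
  have m1: "?m1 \<in> bilinear_maps F ?K ?K ?K" using twA(1) unfolding bil_A by simp
  \<comment> \<open>Unfolding restates the facts on the twisted factors in terms of
    \<open>?K\<close> and \<open>?pure\<close>, so that both products are bilinear maps on one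
    module.\<close>
  note mD = BC'.twisted_tensor_mult[where \<alpha> = \<alpha>, OF mB' mC' F.Units_closed[OF \<alpha>U],
      unfolded twist_tensor_module twist_simps]
  have m2: "?m2 \<in> bilinear_maps F ?K ?K ?K" by (rule mD(1))

  define \<gamma> where "\<gamma> = (\<lambda>(s, t). \<mu> ((s, \<one>\<^bsub>T\<^esub>), (\<one>\<^bsub>S\<^esub>, t)))"
  have \<gamma>U: "\<gamma> (s, t) \<in> Units F" if "s \<in> carrier S" "t \<in> carrier T" for s t
    using that \<mu>U[of "(s, \<one>\<^bsub>T\<^esub>)" "(\<one>\<^bsub>S\<^esub>, t)"] by (simp add: \<gamma>_def)
  define \<delta> where "\<delta> = (\<lambda>x. inv\<^bsub>F\<^esub> (\<gamma> x))"
  have \<delta>U: "\<delta> x \<in> Units F" if "x \<in> carrier ?G" for x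
    using that \<gamma>U by (auto simp: \<delta>_def)
  obtain \<phi> where \<phi>: "\<phi> \<in> linear_maps F ?A ?A" and bij: "bij_betw \<phi> (carrier ?A) (carrier ?A)"
    and \<phi>_hom: "\<And>x X. \<lbrakk>x \<in> carrier ?G; X \<in> hom_part ?A x\<rbrakk> \<Longrightarrow> \<phi> X = \<delta> x \<odot>\<^bsub>?A\<^esub> X"
    and \<phi>_part: "\<And>x. x \<in> carrier ?G \<Longrightarrow> \<phi> ` hom_part ?A x = hom_part ?A x"
    by (rule A.hom_part_rescaling[of \<delta>, OF \<delta>U]) (assumption, rule that)
  have \<phi>_lin: "\<phi> \<in> linear_maps F ?K ?K" using \<phi> unfolding lin_A .
  have \<phi>_pure: "\<phi> (?pure b c) = \<delta> (s, t) \<odot>\<^bsub>?K\<^esub> ?pure b c"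
    if "s \<in> carrier S" "t \<in> carrier T" "b \<in> hom_part B s" "c \<in> hom_part C t" for s t b c
    using \<phi>_hom[of "(s, t)" "?pure b c"] pure_part that by (simp add: A_simps)

  have hom_pure: "\<phi> (?m1 (?pure b c) (?pure b' c')) = ?m2 (\<phi> (?pure b c)) (\<phi> (?pure b' c'))"
    if s: "s \<in> carrier S" "s' \<in> carrier S" and t: "t \<in> carrier T" "t' \<in> carrier T"
      and b: "b \<in> hom_part B s" "b' \<in> hom_part B s'" and c: "c \<in> hom_part C t" "c' \<in> hom_part C t'"
    for s s' t t' b b' c c'
  proof -
    have b_cl: "b \<in> carrier B" "b' \<in> carrier B" and c_cl: "c \<in> carrier C" "c' \<in> carrier C"
      using b c BC.B.hom_part_subset s BC.C.hom_part_subset t by blast+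
    let ?x = "(s, t)" and ?y = "(s', t')" and ?xy = "(s \<otimes>\<^bsub>S\<^esub> s', t \<otimes>\<^bsub>T\<^esub> t')"
    let ?Z = "?pure (b \<otimes>\<^bsub>B\<^esub> b') (c \<otimes>\<^bsub>C\<^esub> c')"
    have pure_cl: "?pure u v \<in> carrier ?K" if "u \<in> carrier B" "v \<in> carrier C" for u v
      by (rule bilinear_maps_closed[OF BC.pure_tensor_bilinear that])
    have Z: "?Z \<in> carrier ?K" using b_cl c_cl by (intro pure_cl) simp_all
    have scalars: "\<mu> (?x, ?y) \<in> carrier F" "\<alpha> (s', t) \<in> carrier F" "\<nu> (s, s') \<in> carrier F" "\<xi> (t, t') \<in> carrier F"
      and \<gamma>s: "\<gamma> ?x \<in> Units F" "\<gamma> ?y \<in> Units F" "\<gamma> ?xy \<in> Units F"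
      using s t \<mu>U[of ?x ?y] \<alpha>U \<nu>U \<xi>U \<gamma>U by (auto intro: F.Units_closed)
    have \<delta>s: "\<delta> ?x \<in> carrier F" "\<delta> ?y \<in> carrier F" "\<delta> ?xy \<in> carrier F"
      and \<gamma>cl: "\<gamma> ?x \<in> carrier F" "\<gamma> ?y \<in> carrier F" "\<gamma> ?xy \<in> carrier F"
      using \<gamma>s by (auto simp: \<delta>_def intro: F.Units_closed)
    have \<delta>\<gamma>: "\<delta> ?x \<otimes>\<^bsub>F\<^esub> \<gamma> ?x = \<one>\<^bsub>F\<^esub>" "\<delta> ?y \<otimes>\<^bsub>F\<^esub> \<gamma> ?y = \<one>\<^bsub>F\<^esub>" "\<gamma> ?xy \<otimes>\<^bsub>F\<^esub> \<delta> ?xy = \<one>\<^bsub>F\<^esub>"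
      using \<gamma>s by (simp_all add: \<delta>_def)
    \<comment> \<open>The coefficient of the target product of b \<otimes> c and b' \<otimes> c'
      relative to the untwisted bb' \<otimes> cc': \<alpha> comes from moving b' past c, \<nu> and
      \<xi> from multiplying inside the twisted factors.\<close>
    let ?\<rho> = "\<alpha> (s', t) \<otimes>\<^bsub>F\<^esub> \<nu> (s, s') \<otimes>\<^bsub>F\<^esub> \<xi> (t, t')"
    have "\<gamma> ?x \<otimes>\<^bsub>F\<^esub> \<gamma> ?y \<otimes>\<^bsub>F\<^esub> \<mu> (?x, ?y) = ?\<rho> \<otimes>\<^bsub>F\<^esub> \<gamma> ?xy"
      using yamazaki_factorization[OF F.is_cring assms(2,3,6,9,10) s t] by (simp add: \<gamma>_def)
    \<comment> \<open>Dividing by the three values of \<gamma> leaves the scalar identity that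
      multiplicativity demands: the left side of \<open>scalar_eq\<close> is the coefficient of the
      image of the product, the right side that of the product of the images.\<close>
    then have "\<delta> ?x \<otimes>\<^bsub>F\<^esub> \<delta> ?y \<otimes>\<^bsub>F\<^esub> (\<gamma> ?x \<otimes>\<^bsub>F\<^esub> \<gamma> ?y \<otimes>\<^bsub>F\<^esub> \<mu> (?x, ?y)) \<otimes>\<^bsub>F\<^esub> \<delta> ?xy
        = \<delta> ?x \<otimes>\<^bsub>F\<^esub> \<delta> ?y \<otimes>\<^bsub>F\<^esub> (?\<rho> \<otimes>\<^bsub>F\<^esub> \<gamma> ?xy) \<otimes>\<^bsub>F\<^esub> \<delta> ?xy" by simp
    moreover have "\<delta> ?x \<otimes>\<^bsub>F\<^esub> \<delta> ?y \<otimes>\<^bsub>F\<^esub> (\<gamma> ?x \<otimes>\<^bsub>F\<^esub> \<gamma> ?y \<otimes>\<^bsub>F\<^esub> \<mu> (?x, ?y)) \<otimes>\<^bsub>F\<^esub> \<delta> ?xy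
        = (\<delta> ?x \<otimes>\<^bsub>F\<^esub> \<gamma> ?x) \<otimes>\<^bsub>F\<^esub> (\<delta> ?y \<otimes>\<^bsub>F\<^esub> \<gamma> ?y) \<otimes>\<^bsub>F\<^esub> (\<mu> (?x, ?y) \<otimes>\<^bsub>F\<^esub> \<delta> ?xy)"
      using \<delta>s \<gamma>cl scalars(1) by (simp add: F.m_ac)
    moreover have "\<delta> ?x \<otimes>\<^bsub>F\<^esub> \<delta> ?y \<otimes>\<^bsub>F\<^esub> (?\<rho> \<otimes>\<^bsub>F\<^esub> \<gamma> ?xy) \<otimes>\<^bsub>F\<^esub> \<delta> ?xy
        = \<delta> ?x \<otimes>\<^bsub>F\<^esub> \<delta> ?y \<otimes>\<^bsub>F\<^esub> ?\<rho> \<otimes>\<^bsub>F\<^esub> (\<gamma> ?xy \<otimes>\<^bsub>F\<^esub> \<delta> ?xy)"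
      using \<delta>s \<gamma>cl scalars by (simp add: F.m_assoc)
    ultimately have scalar_eq: "\<mu> (?x, ?y) \<otimes>\<^bsub>F\<^esub> \<delta> ?xy = \<delta> ?x \<otimes>\<^bsub>F\<^esub> \<delta> ?y \<otimes>\<^bsub>F\<^esub> ?\<rho>"
      using \<delta>\<gamma> \<delta>s scalars by simp
    have "?m1 (?pure b c) (?pure b' c') = \<mu> (?x, ?y) \<odot>\<^bsub>?K\<^esub> ?Z"
      using twA(2)[of ?x ?y] pure_part b c s t mA(2)[OF b_cl(1) c_cl(1) b_cl(2) c_cl(2)]
      by (simp add: A_simps)
    moreover have "\<phi> ?Z = \<delta> ?xy \<odot>\<^bsub>?K\<^esub> ?Z"
      using s t b c by (intro \<phi>_pure B.hom_part_mult C.hom_part_mult) simp_all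
    ultimately have "\<phi> (?m1 (?pure b c) (?pure b' c')) = (\<mu> (?x, ?y) \<otimes>\<^bsub>F\<^esub> \<delta> ?xy) \<odot>\<^bsub>?K\<^esub> ?Z"
      using linear_maps_smult[OF \<phi>_lin scalars(1) Z] scalars \<delta>s Z by (simp add: BC.K.smult_assoc1)
    moreover have "?m2 (\<phi> (?pure b c)) (\<phi> (?pure b' c')) = (\<delta> ?y \<otimes>\<^bsub>F\<^esub> \<delta> ?x \<otimes>\<^bsub>F\<^esub> ?\<rho>) \<odot>\<^bsub>?K\<^esub> ?Z"
    proof -
      \<comment> \<open>Simplification may pull the two scalars out of the pure tensor in either
        order; this reconciles the results.\<close>
      have comm: "\<xi> (t, t') \<odot>\<^bsub>?K\<^esub> (\<nu> (s, s') \<odot>\<^bsub>?K\<^esub> ?Z) = \<nu> (s, s') \<odot>\<^bsub>?K\<^esub> (\<xi> (t, t') \<odot>\<^bsub>?K\<^esub> ?Z)"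
        using scalars Z by (simp add: BC.K.smult_assoc1[symmetric] F.m_comm)
      have "?m2 (\<phi> (?pure b c)) (\<phi> (?pure b' c'))
          = \<delta> ?y \<odot>\<^bsub>?K\<^esub> (\<delta> ?x \<odot>\<^bsub>?K\<^esub> ?m2 (?pure b c) (?pure b' c'))"
        using \<phi>_pure[OF s(1) t(1) b(1) c(1)] \<phi>_pure[OF s(2) t(2) b(2) c(2)] \<delta>s
          pure_cl[OF b_cl(1) c_cl(1)] pure_cl[OF b_cl(2) c_cl(2)]
        by (simp add: linear_maps_smult[OF bilinear_maps_left[OF m2]]
            linear_maps_smult[OF bilinear_maps_right[OF m2]])
      also have "?m2 (?pure b c) (?pure b' c') = \<alpha> (s', t) \<odot>\<^bsub>?K\<^esub> ?pure (b \<otimes>\<^bsub>?B\<^esub> b') (c \<otimes>\<^bsub>?C\<^esub> c')"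
        by (rule mD(2)[OF _ _ b_cl(1) c(1) b(2) c_cl(2) s(2) t(1)])
      also have "?pure (b \<otimes>\<^bsub>?B\<^esub> b') (c \<otimes>\<^bsub>?C\<^esub> c') = \<nu> (s, s') \<odot>\<^bsub>?K\<^esub> (\<xi> (t, t') \<odot>\<^bsub>?K\<^esub> ?Z)"
        using twB(2)[OF _ _ s b] twC(2)[OF _ _ t c] b_cl c_cl scalars comm
        by (simp add: linear_maps_smult[OF bilinear_maps_left[OF BC.pure_tensor_bilinear]]
            linear_maps_smult[OF bilinear_maps_right[OF BC.pure_tensor_bilinear]])
      finally show ?thesis using \<delta>s scalars Z by (simp add: BC.K.smult_assoc1)
    qed
    ultimately show ?thesis using F.m_comm[OF \<delta>s(1,2)] by (simp add: scalar_eq)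
  qed

  have mult: "\<phi> (?m1 X Y) = ?m2 (\<phi> X) (\<phi> Y)" if X: "X \<in> carrier ?K" and Y: "Y \<in> carrier ?K" for X Y
  proof -
    note eqI = BC.linear_maps_eq_on_homogeneous_tensors[OF BC.K.module_axioms]
    note lhs_right = linear_maps_comp[OF bilinear_maps_right[OF m1] \<phi>_lin]
      and lhs_left = linear_maps_comp[OF bilinear_maps_left[OF m1] \<phi>_lin]
      and rhs_right = linear_maps_comp[OF \<phi>_lin bilinear_maps_right[OF m2 linear_maps_closed[OF \<phi>_lin]]]
      and rhs_left = linear_maps_comp[OF \<phi>_lin bilinear_maps_left[OF m2 linear_maps_closed[OF \<phi>_lin]]]
    have pure_cl: "?pure b c \<in> carrier ?K"
      if "s \<in> carrier S" "t \<in> carrier T" "b \<in> hom_part B s" "c \<in> hom_part C t" for s t b c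
      using BC.B.hom_part_subset[OF that(1)] BC.C.hom_part_subset[OF that(2)] that(3,4)
      by (blast intro: bilinear_maps_closed[OF BC.pure_tensor_bilinear])
    \<comment> \<open>The arguments are generalized one at a time: Y with a homogeneous pure tensor
      on the left, then X with Y arbitrary. In each case both sides are linear in the free
      argument.\<close>
    have "\<phi> (?m1 (?pure b c) Y) = ?m2 (\<phi> (?pure b c)) (\<phi> Y)"
      if "s \<in> carrier S" "t \<in> carrier T" "b \<in> hom_part B s" "c \<in> hom_part C t" for s t b c
      by (rule eqI[OF lhs_right[OF pure_cl[OF that]] rhs_right[OF pure_cl[OF that]] _ Y])
        (rule hom_pure[OF that(1) _ that(2) _ that(3) _ that(4)])
    then show ?thesis
      by (rule eqI[OF lhs_left[OF Y] rhs_left[OF Y] _ X])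
  qed
  \<comment> \<open>Normalization of \<mu> gives \<gamma> = 1 in the degree of the unit, so the
    rescaling fixes the unit, which is the same tensor in both algebras.\<close>
  have "\<gamma> (\<one>\<^bsub>S\<^esub>, \<one>\<^bsub>T\<^esub>) = \<one>\<^bsub>F\<^esub>"
    using cocycle_one[OF assms(6), of "(\<one>\<^bsub>S\<^esub>, \<one>\<^bsub>T\<^esub>)"] by (simp add: \<gamma>_def)
  then have "\<phi> (?pure \<one>\<^bsub>B\<^esub> \<one>\<^bsub>C\<^esub>) = ?pure \<one>\<^bsub>B\<^esub> \<one>\<^bsub>C\<^esub>"
    using \<phi>_pure[OF S.one_closed T.one_closed B.hom_part_one C.hom_part_one]
      bilinear_maps_closed[OF BC.pure_tensor_bilinear B.one_closed C.one_closed]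
    by (simp add: \<delta>_def)
  then have "\<phi> \<in> ring_iso (twist ?G ?A \<mu>) ?D"
    using mult bij linear_maps_closed[OF \<phi>_lin] linear_maps_add[OF \<phi>_lin]
    by (simp add: ring_iso_def ring_hom_def twist_simps A_simps D_simps one Pi_iff)
  then have "\<phi> \<in> graded_algebra_iso F ?G (twist ?G ?A \<mu>) ?D"
    using linear_maps_smult[OF \<phi>_lin] \<phi>_part
    by (simp add: graded_algebra_iso_def twist_simps A_simps D_simps part)
  then show ?thesis unfolding graded_isomorphic_def by blast
qed

end
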